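(* Let $E$ be a directed graph and let $R$ be a subring of $\mathbb{C}$ that is closed under complex conjugation, contains $1$ and is kind. If $p\in L_R(E)$ is a projection, then $p\in D_R(E)$.
   Context: **Kind rings.** A subring $R$ of $\mathbb{C}$ that is closed under complex conjugation and contains $1$ is called kind if whenever $\lambda_0,\lambda_1,\dots,\lambda_n\in R$ satisfy $\lambda_0=\sum_{i=0}^n|\lambda_i|^2$, then $\lambda_1=\dots=\lambda_n=0$. **Directed graphs.** A directed graph is a quadruple $E=(E^0,E^1,s,r)$ where $E^0$ and $E^1$ are (arbitrary) sets and $s,r:E^1\to E^0$ are maps. A path of length $n\ge 1$ is a sequence of edges $\mu=\mu_1\cdots\mu_n$ with $r(\mu_i)=s(\mu_{i+1})$ for $1\le i\le n-1$; set $|\mu|=n$, $s(\mu)=s(\mu_1)$, $r(\mu)=r(\mu_n)$. Vertices $v\in E^0$ are regarded as paths of length $0$ with $s(v)=r(v)=v$. $E^n$ is the set of paths of length $n$, $E^*=\bigcup_{n\ge 0}E^n$, and $vE^1$ is the set of edges with source $v$. Put $E^0_{\mathrm{reg}}=\{v\in E^0: vE^1\text{ is finite and nonempty}\}$. **Leavitt path algebras.** For a subring $R$ of $\mathbb{C}$ that is closed under complex conjugation and contains $1$, $L_R(E)$ is the universal (associative, not necessarily unital) $R$-algebra generated by pairwise orthogonal idempotents $\{v:v\in E^0\}$ and elements $\{e,e^*:e\in E^1\}$ satisfying: (LP1) $e^*f=0$ if $e\neq f$; (LP2) $e^*e=r(e)$; (LP3) $s(e)e=e=er(e)$; (LP4)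 $e^*s(e)=e^*=r(e)e^*$; (LP5) $v=\sum_{e\in vE^1}ee^*$ if $v\in E^0_{\mathrm{reg}}$. For $\mu=\mu_1\cdots\mu_n\in E^n$, $\mu$ also denotes the product $\mu_1\cdots\mu_n\in L_R(E)$ and $\mu^*=\mu_n^*\cdots\mu_1^*$; for $v\in E^0$, $v^*=v$. Then $L_R(E)=\operatorname{span}_R\{\mu\nu^*:\mu,\nu\in E^*,\ r(\mu)=r(\nu)\}$. The assignment $\mu\nu^*\mapsto\nu\mu^*$ extends to a conjugate linear involution on $L_R(E)$, making it a $*$-algebra over $R$. The diagonal is $D_R(E)=\operatorname{span}_R\{\mu\mu^*:\mu\in E^*\}$. An element $p\in L_R(E)$ is a projection if $p=p^*=p^2$. *)

theory Defs
  imports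
    Complex_Main
    "HOL-Library.Poly_Mapping"
    "Graph_Theory.Arc_Walk"
begin

section \<open>Kind rings\<close>

definition conj_subring :: "complex set \<Rightarrow> bool" where
  "conj_subring R \<longleftrightarrow>
     0 \<in> R \<and> 1 \<in> R \<and> (\<forall>x\<in>R. - x \<in> R) \<and> (\<forall>x\<in>R. \<forall>y\<in>R. x + y \<in> R) \<and>
     (\<forall>x\<in>R. \<forall>y\<in>R. x * y \<in> R) \<and> (\<forall>x\<in>R. cnj x \<in> R)"

definition kind :: "complex set \<Rightarrow> bool" where
  "kind R \<longleftrightarrow>
     (\<forall>(n::nat) (l :: nat \<Rightarrow> complex).
        (\<forall>i\<le>n. l i \<in> R) \<longrightarrow> l 0 = of_real (\<Sum>i=0..n. (cmod (l i))\<^sup>2) \<longrightarrow>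
        (\<forall>i\<in>{1..n}. l i = 0))"

section \<open>Words and free algebras\<close>

text \<open>The free monoid is written additively, so that the convolution product of
  \<open>'g fmon \<Rightarrow>\<^sub>0 complex\<close> is the product of the free algebra.\<close>

datatype 'g fmon = Word (letters: "'g list")

instantiation fmon :: (type) monoid_add
begin

definition "0 = Word []"

definition "v + w = Word (letters v @ letters w)"

instance
  by standard (simp_all add: zero_fmon_def plus_fmon_def)

end

definition fscale :: "complex \<Rightarrow> ('g fmon \<Rightarrow>\<^sub>0 complex) \<Rightarrow> ('g fmon \<Rightarrow>\<^sub>0 complex)" where
  "fscale c = Poly_Mapping.map ((*) c)"

definition fgen :: "'g \<Rightarrow> ('g fmon \<Rightarrow>\<^sub>0 complex)" where
  "fgen g = Poly_Mapping.single (Word [g]) 1"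

text \<open>The free algebra over \<open>R\<close> on the set \<open>G\<close>, without unit: the empty word is excluded.\<close>

definition free_alg :: "complex set \<Rightarrow> 'g set \<Rightarrow> ('g fmon \<Rightarrow>\<^sub>0 complex) set" where
  "free_alg R G =
     {x. (\<forall>w. Poly_Mapping.lookup x w \<in> R) \<and>
         (\<forall>w\<in>Poly_Mapping.keys x. letters w \<noteq> [] \<and> set (letters w) \<subseteq> G)}"

section \<open>Leavitt path algebras\<close>

text \<open>A directed graph \<open>(E\<^sup>0, E\<^sup>1, s, r)\<close> is a \<^const>\<open>wf_digraph\<close> with
  \<open>E\<^sup>0 = verts E\<close>, \<open>E\<^sup>1 = arcs E\<close>, \<open>s = tail E\<close>, \<open>r = head E\<close>. A path \<open>\<mu>\<close> is a pair of its source
  \<open>u\<close> and its list \<open>p\<close> of edges; \<open>pre_digraph.awalk E u p v\<close> says that \<open>\<mu>\<close> is a path with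
  \<open>s(\<mu>) = u\<close> and \<open>r(\<mu>) = v\<close>, and \<open>p = []\<close> gives the vertices.\<close>

datatype ('v, 'e) lpa_gen = Vert 'v | Edge 'e | Ghost 'e

type_synonym ('v, 'e) lpa_free = "('v, 'e) lpa_gen fmon \<Rightarrow>\<^sub>0 complex"

definition lpa_gens :: "('v, 'e) pre_digraph \<Rightarrow> ('v, 'e) lpa_gen set" where
  "lpa_gens E = Vert ` verts E \<union> Edge ` arcs E \<union> Ghost ` arcs E"

definition regular_verts :: "('v, 'e) pre_digraph \<Rightarrow> 'v set" where
  "regular_verts E = {v \<in> verts E. finite (out_arcs E v) \<and> out_arcs E v \<noteq> {}}"

text \<open>An element \<open>a - b\<close> (or \<open>a\<close>) stands for the defining relation \<open>a = b\<close> (or \<open>a = 0\<close>).\<close>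

inductive_set lpa_rels :: "('v, 'e) pre_digraph \<Rightarrow> ('v, 'e) lpa_free set"
  for E :: "('v, 'e) pre_digraph" where
  idem: "v \<in> verts E \<Longrightarrow> fgen (Vert v) * fgen (Vert v) - fgen (Vert v) \<in> lpa_rels E"
| orth: "\<lbrakk>v \<in> verts E; w \<in> verts E; v \<noteq> w\<rbrakk> \<Longrightarrow> fgen (Vert v) * fgen (Vert w) \<in> lpa_rels E"
| LP1: "\<lbrakk>e \<in> arcs E; f \<in> arcs E; e \<noteq> f\<rbrakk> \<Longrightarrow> fgen (Ghost e) * fgen (Edge f) \<in> lpa_rels E"
| LP2: "e \<in> arcs E \<Longrightarrow> fgen (Ghost e) * fgen (Edge e) - fgen (Vert (head E e)) \<in> lpa_rels E"
| LP3_s: "e \<in> arcs E \<Longrightarrow> fgen (Vert (tail E e)) * fgen (Edge e) - fgen (Edge e) \<in> lpa_rels E"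
| LP3_r: "e \<in> arcs E \<Longrightarrow> fgen (Edge e) * fgen (Vert (head E e)) - fgen (Edge e) \<in> lpa_rels E"
| LP4_s: "e \<in> arcs E \<Longrightarrow> fgen (Ghost e) * fgen (Vert (tail E e)) - fgen (Ghost e) \<in> lpa_rels E"
| LP4_r: "e \<in> arcs E \<Longrightarrow> fgen (Vert (head E e)) * fgen (Ghost e) - fgen (Ghost e) \<in> lpa_rels E"
| LP5: "v \<in> regular_verts E \<Longrightarrow>
    fgen (Vert v) - (\<Sum>e\<in>out_arcs E v. fgen (Edge e) * fgen (Ghost e)) \<in> lpa_rels E"

inductive_set lpa_ideal :: "complex set \<Rightarrow> ('v, 'e) pre_digraph \<Rightarrow> ('v, 'e) lpa_free set"
  for R :: "complex set" and E :: "('v, 'e) pre_digraph" where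
  rel: "x \<in> lpa_rels E \<Longrightarrow> x \<in> lpa_ideal R E"
| zero: "0 \<in> lpa_ideal R E"
| add: "\<lbrakk>x \<in> lpa_ideal R E; y \<in> lpa_ideal R E\<rbrakk> \<Longrightarrow> x + y \<in> lpa_ideal R E"
| scale: "\<lbrakk>c \<in> R; x \<in> lpa_ideal R E\<rbrakk> \<Longrightarrow> fscale c x \<in> lpa_ideal R E"
| mult_left: "\<lbrakk>x \<in> free_alg R (lpa_gens E); y \<in> lpa_ideal R E\<rbrakk> \<Longrightarrow> x * y \<in> lpa_ideal R E"
| mult_right: "\<lbrakk>x \<in> lpa_ideal R E; y \<in> free_alg R (lpa_gens E)\<rbrakk> \<Longrightarrow> x * y \<in> lpa_ideal R E"

definition lpa_cong :: "complex set \<Rightarrow> ('v, 'e) pre_digraph \<Rightarrow> ('v, 'e) lpa_free rel" where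
  "lpa_cong R E =
     {(x, y). x \<in> free_alg R (lpa_gens E) \<and> y \<in> free_alg R (lpa_gens E) \<and> x - y \<in> lpa_ideal R E}"

abbreviation lpa_class ::
    "complex set \<Rightarrow> ('v, 'e) pre_digraph \<Rightarrow> ('v, 'e) lpa_free \<Rightarrow> ('v, 'e) lpa_free set" where
  "lpa_class R E x \<equiv> lpa_cong R E `` {x}"

definition lpa :: "complex set \<Rightarrow> ('v, 'e) pre_digraph \<Rightarrow> ('v, 'e) lpa_free set set" where
  "lpa R E = free_alg R (lpa_gens E) // lpa_cong R E"

definition lpa_add ::
    "complex set \<Rightarrow> ('v, 'e) pre_digraph \<Rightarrow>
     ('v, 'e) lpa_free set \<Rightarrow> ('v, 'e) lpa_free set \<Rightarrow> ('v, 'e) lpa_free set" where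
  "lpa_add R E X Y = (\<Union>x\<in>X. \<Union>y\<in>Y. lpa_class R E (x + y))"

definition lpa_scale ::
    "complex set \<Rightarrow> ('v, 'e) pre_digraph \<Rightarrow>
     complex \<Rightarrow> ('v, 'e) lpa_free set \<Rightarrow> ('v, 'e) lpa_free set" where
  "lpa_scale R E c X = (\<Union>x\<in>X. lpa_class R E (fscale c x))"

definition lpa_mult ::
    "complex set \<Rightarrow> ('v, 'e) pre_digraph \<Rightarrow>
     ('v, 'e) lpa_free set \<Rightarrow> ('v, 'e) lpa_free set \<Rightarrow> ('v, 'e) lpa_free set" where
  "lpa_mult R E X Y = (\<Union>x\<in>X. \<Union>y\<in>Y. lpa_class R E (x * y))"

primrec gen_star :: "('v, 'e) lpa_gen \<Rightarrow> ('v, 'e) lpa_gen" where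
  "gen_star (Vert v) = Vert v"
| "gen_star (Edge e) = Ghost e"
| "gen_star (Ghost e) = Edge e"

definition word_star :: "('v, 'e) lpa_gen fmon \<Rightarrow> ('v, 'e) lpa_gen fmon" where
  "word_star w = Word (map gen_star (rev (letters w)))"

lemma gen_star_gen_star [simp]: "gen_star (gen_star g) = g"
  by (cases g) simp_all

lemma word_star_word_star [simp]: "word_star (word_star w) = w"
  by (simp add: word_star_def rev_map comp_def)

text \<open>The conjugate linear extension of \<^const>\<open>word_star\<close>. As \<^const>\<open>word_star\<close> is an involution,
  the coefficient of \<open>x\<^sup>*\<close> at \<open>w\<close> is the conjugate of that of \<open>x\<close> at \<open>w\<^sup>*\<close>.\<close>

lift_definition fstar :: "('v, 'e) lpa_free \<Rightarrow> ('v, 'e) lpa_free"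
  is "\<lambda>x w. cnj (x (word_star w))"
proof -
  fix x :: "('v, 'e) lpa_gen fmon \<Rightarrow> complex"
  assume "finite {w. x w \<noteq> 0}"
  moreover have "{w. cnj (x (word_star w)) \<noteq> 0} \<subseteq> word_star ` {w. x w \<noteq> 0}"
  proof
    fix w assume "w \<in> {w. cnj (x (word_star w)) \<noteq> 0}"
    then have "word_star w \<in> {w. x w \<noteq> 0}" by simp
    then show "w \<in> word_star ` {w. x w \<noteq> 0}" by (rule rev_image_eqI) simp
  qed
  ultimately show "finite {w. cnj (x (word_star w)) \<noteq> 0}"
    by (rule finite_surj)
qed

definition lpa_star ::
    "complex set \<Rightarrow> ('v, 'e) pre_digraph \<Rightarrow> ('v, 'e) lpa_free set \<Rightarrow> ('v, 'e) lpa_free set" where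
  "lpa_star R E X = (\<Union>x\<in>X. lpa_class R E (fstar x))"

definition path_word :: "'v \<Rightarrow> 'e list \<Rightarrow> ('v, 'e) lpa_gen fmon" where
  "path_word u p = Word (if p = [] then [Vert u] else map Edge p)"

definition lpa_path ::
    "complex set \<Rightarrow> ('v, 'e) pre_digraph \<Rightarrow> 'v \<Rightarrow> 'e list \<Rightarrow> ('v, 'e) lpa_free set" where
  "lpa_path R E u p = lpa_class R E (Poly_Mapping.single (path_word u p) 1)"

inductive_set lpa_span ::
    "complex set \<Rightarrow> ('v, 'e) pre_digraph \<Rightarrow> ('v, 'e) lpa_free set set \<Rightarrow> ('v, 'e) lpa_free set set"
  for R :: "complex set" and E :: "('v, 'e) pre_digraph" and S :: "('v, 'e) lpa_free set set" where
  zero: "lpa_class R E 0 \<in> lpa_span R E S"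
| step: "\<lbrakk>c \<in> R; X \<in> S; Y \<in> lpa_span R E S\<rbrakk> \<Longrightarrow>
    lpa_add R E (lpa_scale R E c X) Y \<in> lpa_span R E S"

definition lpa_diag :: "complex set \<Rightarrow> ('v, 'e) pre_digraph \<Rightarrow> ('v, 'e) lpa_free set set" where
  "lpa_diag R E =
     lpa_span R E {lpa_mult R E (lpa_path R E u p) (lpa_star R E (lpa_path R E u p)) | u p v.
                     pre_digraph.awalk E u p v}"

definition lpa_projection ::
    "complex set \<Rightarrow> ('v, 'e) pre_digraph \<Rightarrow> ('v, 'e) lpa_free set \<Rightarrow> bool" where
  "lpa_projection R E p \<longleftrightarrow> p \<in> lpa R E \<and> lpa_star R E p = p \<and> lpa_mult R E p p = p"

section \<open>The operations are well defined\<close>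

lemma lookup_fscale: "Poly_Mapping.lookup (fscale c x) w = c * Poly_Mapping.lookup x w"
  unfolding fscale_def by transfer (simp add: when_def)

lemma lookup_fstar: "Poly_Mapping.lookup (fstar x) w = cnj (Poly_Mapping.lookup x (word_star w))"
  by transfer simp

lemma fscale_add: "fscale c (x + y) = fscale c x + fscale c y"
  by (rule poly_mapping_eqI) (simp add: lookup_fscale lookup_add algebra_simps)

lemma fscale_diff: "fscale c (x - y) = fscale c x - fscale c y"
  by (rule poly_mapping_eqI) (simp add: lookup_fscale lookup_minus algebra_simps)

lemma fscale_minus_one: "fscale (- 1) x = - x"
  by (rule poly_mapping_eqI) (simp add: lookup_fscale)

lemma fstar_zero [simp]: "fstar 0 = 0"
  by (rule poly_mapping_eqI) (simp add: lookup_fstar)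

lemma fstar_add: "fstar (x + y) = fstar x + fstar y"
  by (rule poly_mapping_eqI) (simp add: lookup_fstar lookup_add)

lemma fstar_diff: "fstar (x - y) = fstar x - fstar y"
  by (rule poly_mapping_eqI) (simp add: lookup_fstar lookup_minus)

lemma fstar_sum: "fstar (sum f A) = (\<Sum>a\<in>A. fstar (f a))"
  by (induction A rule: infinite_finite_induct) (simp_all add: fstar_add)

lemma fstar_fscale: "fstar (fscale c x) = fscale (cnj c) (fstar x)"
  by (rule poly_mapping_eqI) (simp add: lookup_fstar lookup_fscale)

lemma fstar_fstar [simp]: "fstar (fstar x) = x"
  by (rule poly_mapping_eqI) (simp add: lookup_fstar)

lemma fstar_single: "fstar (Poly_Mapping.single w c) = Poly_Mapping.single (word_star w) (cnj c)"
  by (rule poly_mapping_eqI) (auto simp: lookup_fstar lookup_single when_def)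

lemma fstar_fgen: "fstar (fgen g) = fgen (gen_star g)"
  by (simp add: fgen_def fstar_single word_star_def)

lemma word_star_add: "word_star (v + w) = word_star w + word_star v"
  by (simp add: word_star_def plus_fmon_def)

lemma poly_mapping_add_induct [case_names zero add]:
  assumes "P 0" and "\<And>x w c. P x \<Longrightarrow> P (Poly_Mapping.single w c + x)"
  shows "P (x :: 'a \<Rightarrow>\<^sub>0 'b :: ab_group_add)"
proof (induction x rule: Poly_Mapping.update_induct)
  case const
  show ?case by (rule assms)
next
  case (update f a b)
  have "Poly_Mapping.update a b f = Poly_Mapping.single a b + f"
    by (rule poly_mapping_eqI)
      (use update in \<open>auto simp: lookup_update lookup_add lookup_single when_def in_keys_iff\<close>)
  then show ?case using assms(2) update by simp
qed

lemma fstar_mult: "fstar (x * y) = fstar y * fstar x"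
proof (induction x rule: poly_mapping_add_induct)
  case zero
  show ?case by simp
next
  case (add x v c)
  have "fstar (Poly_Mapping.single v c * y) = fstar y * fstar (Poly_Mapping.single v c)"
    by (induction y rule: poly_mapping_add_induct)
      (simp_all add: fstar_add fstar_single mult_single word_star_add distrib_left distrib_right mult.commute)
  with add show ?case by (simp add: fstar_add distrib_left distrib_right)
qed

lemma Sum_any_closed:
  assumes "0 \<in> R" and "\<And>x y. x \<in> R \<Longrightarrow> y \<in> R \<Longrightarrow> x + y \<in> R" and "\<And>a. f a \<in> R"
  shows "Sum_any f \<in> R"
proof -
  have "sum f A \<in> R" for A
    by (induction A rule: infinite_finite_induct) (use assms in auto)
  then show ?thesis by (simp add: Sum_any.expand_set)
qed

locale lpa_setting = wf_digraph E for E :: "('v, 'e) pre_digraph" +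
  fixes R :: "complex set"
  assumes R: "conj_subring R"
begin

abbreviation "F \<equiv> free_alg R (lpa_gens E)"
abbreviation "I \<equiv> lpa_ideal R E"
abbreviation "cls \<equiv> lpa_class R E"

lemma R_simps:
  "0 \<in> R" "1 \<in> R" "x \<in> R \<Longrightarrow> - x \<in> R" "x \<in> R \<Longrightarrow> y \<in> R \<Longrightarrow> x + y \<in> R"
  "x \<in> R \<Longrightarrow> y \<in> R \<Longrightarrow> x * y \<in> R" "x \<in> R \<Longrightarrow> cnj x \<in> R"
  using R by (auto simp: conj_subring_def)

lemma F_zero: "0 \<in> F"
  by (simp add: free_alg_def R_simps)

lemma F_add: "x \<in> F \<Longrightarrow> y \<in> F \<Longrightarrow> x + y \<in> F"
  unfolding free_alg_def using Poly_Mapping.keys_add [of x y]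
  by (simp add: lookup_add R_simps) blast

lemma F_scale: "c \<in> R \<Longrightarrow> x \<in> F \<Longrightarrow> fscale c x \<in> F"
  by (auto simp: free_alg_def lookup_fscale R_simps in_keys_iff)

lemma F_diff: "x \<in> F \<Longrightarrow> y \<in> F \<Longrightarrow> x - y \<in> F"
  using F_add [of x "fscale (- 1) y"] F_scale [of "- 1" y] by (simp add: fscale_minus_one R_simps)

lemma F_sum: "(\<And>a. a \<in> A \<Longrightarrow> f a \<in> F) \<Longrightarrow> sum f A \<in> F"
  by (induction A rule: infinite_finite_induct) (simp_all add: F_zero F_add)

lemma F_mult:
  assumes "x \<in> F" "y \<in> F" shows "x * y \<in> F"
proof -
  have "Poly_Mapping.lookup (x * y) w \<in> R" for w
    unfolding lookup_mult using assms
    by (intro Sum_any_closed R_simps) (auto simp: free_alg_def when_def R_simps)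
  moreover have "letters w \<noteq> [] \<and> set (letters w) \<subseteq> lpa_gens E"
    if "w \<in> Poly_Mapping.keys (x * y)" for w
  proof -
    from that keys_mult [of x y] obtain a b
      where "w = a + b" "a \<in> Poly_Mapping.keys x" "b \<in> Poly_Mapping.keys y" by auto
    with assms show ?thesis by (auto simp: free_alg_def plus_fmon_def)
  qed
  ultimately show ?thesis by (simp add: free_alg_def)
qed

lemma gen_star_gens: "g \<in> lpa_gens E \<Longrightarrow> gen_star g \<in> lpa_gens E"
  by (auto simp: lpa_gens_def)

lemma F_star: "x \<in> F \<Longrightarrow> fstar x \<in> F"
proof -
  assume x: "x \<in> F"
  have "letters w \<noteq> [] \<and> set (letters w) \<subseteq> lpa_gens E" if "w \<in> Poly_Mapping.keys (fstar x)" for w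
  proof -
    have "word_star w \<in> Poly_Mapping.keys x" using that by (simp add: in_keys_iff lookup_fstar)
    then have *: "letters (word_star w) \<noteq> []" "set (letters (word_star w)) \<subseteq> lpa_gens E"
      using x by (auto simp: free_alg_def)
    show ?thesis
    proof
      show "letters w \<noteq> []" using *(1) by (simp add: word_star_def)
      have "letters w = map gen_star (rev (letters (word_star w)))"
        by (simp add: word_star_def rev_map comp_def)
      then show "set (letters w) \<subseteq> lpa_gens E" using *(2) gen_star_gens by auto
    qed
  qed
  then show ?thesis using x by (auto simp: free_alg_def lookup_fstar R_simps)
qed

lemma F_gen: "g \<in> lpa_gens E \<Longrightarrow> fgen g \<in> F"
  by (auto simp: free_alg_def fgen_def lookup_single when_def R_simps)

lemma F_single: "c \<in> R \<Longrightarrow> letters w \<noteq> [] \<Longrightarrow> set (letters w) \<subseteq> lpa_gens E \<Longrightarrow>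
    Poly_Mapping.single w c \<in> F"
  by (auto simp: free_alg_def lookup_single when_def R_simps)

lemma gens_iff:
  "Vert v \<in> lpa_gens E \<longleftrightarrow> v \<in> verts E" "Edge e \<in> lpa_gens E \<longleftrightarrow> e \<in> arcs E"
  "Ghost e \<in> lpa_gens E \<longleftrightarrow> e \<in> arcs E"
  by (auto simp: lpa_gens_def)

lemma rels_F: "x \<in> lpa_rels E \<Longrightarrow> x \<in> F"
  by (induction rule: lpa_rels.induct)
    (auto intro!: F_diff F_mult F_sum F_gen simp: gens_iff regular_verts_def)

lemma ideal_F: "x \<in> I \<Longrightarrow> x \<in> F"
  by (induction rule: lpa_ideal.induct) (auto intro: rels_F F_zero F_add F_scale F_mult)

lemma ideal_uminus: "x \<in> I \<Longrightarrow> - x \<in> I"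
  using lpa_ideal.scale [of "- 1" R x E] by (simp add: fscale_minus_one R_simps)

lemma ideal_diff: "x \<in> I \<Longrightarrow> y \<in> I \<Longrightarrow> x - y \<in> I"
  using lpa_ideal.add [of x R E "- y"] ideal_uminus [of y] by simp

lemma rels_star: "x \<in> lpa_rels E \<Longrightarrow> fstar x \<in> lpa_rels E"
proof (induction rule: lpa_rels.induct)
  case (LP1 e f)
  then show ?case using lpa_rels.LP1 [of f E e] by (simp add: fstar_mult fstar_fgen)
qed (auto simp: fstar_diff fstar_sum fstar_mult fstar_fgen intro: lpa_rels.intros)

lemma ideal_star: "x \<in> I \<Longrightarrow> fstar x \<in> I"
  by (induction rule: lpa_ideal.induct)
    (auto simp: fstar_add fstar_fscale fstar_mult R_simps
      intro: lpa_ideal.intros rels_star F_star)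

lemma cong_equiv: "equiv F (lpa_cong R E)"
proof (rule equivI)
  show "lpa_cong R E \<subseteq> F \<times> F" by (auto simp: lpa_cong_def)
  show "refl_on F (lpa_cong R E)"
    by (auto simp: refl_on_def lpa_cong_def intro: lpa_ideal.zero)
  show "sym (lpa_cong R E)"
    by (auto simp: sym_def lpa_cong_def dest: ideal_uminus)
  show "trans (lpa_cong R E)"
  proof (rule transI)
    fix x y z assume "(x, y) \<in> lpa_cong R E" "(y, z) \<in> lpa_cong R E"
    then show "(x, z) \<in> lpa_cong R E"
      using lpa_ideal.add [of "x - y" R E "y - z"] by (simp add: lpa_cong_def)
  qed
qed

lemma congD: "(x, y) \<in> lpa_cong R E \<Longrightarrow> x \<in> F \<and> y \<in> F \<and> x - y \<in> I"
  by (simp add: lpa_cong_def)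

lemma cls_eq_iff: "x \<in> F \<Longrightarrow> y \<in> F \<Longrightarrow> cls x = cls y \<longleftrightarrow> x - y \<in> I"
  using eq_equiv_class_iff [OF cong_equiv, of x y] by (simp add: lpa_cong_def)

lemma lpa_add_cls:
  assumes "x \<in> F" "y \<in> F" shows "lpa_add R E (cls x) (cls y) = cls (x + y)"
proof -
  have "congruent2 (lpa_cong R E) (lpa_cong R E) (\<lambda>x y. cls (x + y))"
  proof (rule congruent2I [OF cong_equiv cong_equiv])
    fix x y z assume a: "(x, y) \<in> lpa_cong R E" "z \<in> F"
    then show "cls (x + z) = cls (y + z)" by (simp add: cls_eq_iff F_add congD)
  next
    fix x y z assume a: "(x, y) \<in> lpa_cong R E" "z \<in> F"
    then show "cls (z + x) = cls (z + y)" by (simp add: cls_eq_iff F_add congD)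
  qed
  from UN_equiv_class2 [OF cong_equiv cong_equiv this assms] show ?thesis
    by (simp add: lpa_add_def)
qed

lemma lpa_mult_cls:
  assumes "x \<in> F" "y \<in> F" shows "lpa_mult R E (cls x) (cls y) = cls (x * y)"
proof -
  have "congruent2 (lpa_cong R E) (lpa_cong R E) (\<lambda>x y. cls (x * y))"
  proof (rule congruent2I [OF cong_equiv cong_equiv])
    fix x y z assume a: "(x, y) \<in> lpa_cong R E" "z \<in> F"
    then have "(x - y) * z \<in> I" by (auto dest: congD intro: lpa_ideal.mult_right)
    with a show "cls (x * z) = cls (y * z)"
      by (simp add: cls_eq_iff F_mult congD left_diff_distrib)
  next
    fix x y z assume a: "(x, y) \<in> lpa_cong R E" "z \<in> F"
    then have "z * (x - y) \<in> I" by (auto dest: congD intro: lpa_ideal.mult_left)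
    with a show "cls (z * x) = cls (z * y)"
      by (simp add: cls_eq_iff F_mult congD right_diff_distrib)
  qed
  from UN_equiv_class2 [OF cong_equiv cong_equiv this assms] show ?thesis
    by (simp add: lpa_mult_def)
qed

lemma lpa_scale_cls:
  assumes "c \<in> R" "x \<in> F" shows "lpa_scale R E c (cls x) = cls (fscale c x)"
proof -
  have "cls (fscale c y) = cls (fscale c z)" if "(y, z) \<in> lpa_cong R E" for y z
  proof -
    have "fscale c y - fscale c z \<in> I"
      unfolding fscale_diff [symmetric] using assms(1) that by (auto dest: congD intro: lpa_ideal.scale)
    then show ?thesis using assms(1) that by (simp add: cls_eq_iff F_scale congD)
  qed
  then have "congruent (lpa_cong R E) (\<lambda>x. cls (fscale c x))"
    by (rule congruentI)
  from UN_equiv_class [OF cong_equiv this assms(2)] show ?thesis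
    by (simp add: lpa_scale_def)
qed

lemma lpa_star_cls:
  assumes "x \<in> F" shows "lpa_star R E (cls x) = cls (fstar x)"
proof -
  have "cls (fstar y) = cls (fstar z)" if "(y, z) \<in> lpa_cong R E" for y z
  proof -
    have "fstar y - fstar z \<in> I"
      unfolding fstar_diff [symmetric] using that by (auto dest: congD intro: ideal_star)
    then show ?thesis using assms(1) that by (simp add: cls_eq_iff F_star congD)
  qed
  then have "congruent (lpa_cong R E) (\<lambda>x. cls (fstar x))"
    by (rule congruentI)
  from UN_equiv_class [OF cong_equiv this assms] show ?thesis
    by (simp add: lpa_star_def)
qed

lemma path_F: "awalk u p v \<Longrightarrow> Poly_Mapping.single (path_word u p) 1 \<in> F"
  by (rule F_single) (auto simp: R_simps path_word_def awalk_def lpa_gens_def)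

text \<open>\<open>(\<mu>\<nu>\<^sup>*)\<^sup>* = \<nu>\<mu>\<^sup>*\<close>\<close>

lemma lpa_star_path:
  assumes "awalk u p w" "awalk v q w"
  shows "lpa_star R E (lpa_mult R E (lpa_path R E u p) (lpa_star R E (lpa_path R E v q))) =
           lpa_mult R E (lpa_path R E v q) (lpa_star R E (lpa_path R E u p))"
  using assms [THEN path_F]
  by (simp add: lpa_path_def lpa_star_cls lpa_mult_cls F_star F_mult fstar_mult)

end

end

theory Submission
  imports Defs
begin

text \<open>Let the free algebra act on functions on the finite paths of \<open>E\<close>: an edge is prepended to a
  path, a ghost edge strips it off, and a vertex fixes the paths that start there. All relations
  except (LP5) hold for this action; (LP5) fails at a regular vertex \<open>v\<close>, but only on the path \<open>v\<close> of
  length \<open>0\<close>. Call a path \<open>N\<close>-deep if its length is at least \<open>N\<close> or its range is not regular. Each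
  element of the defining ideal uses (LP5) finitely often, after words of bounded length, and so
  vanishes on all \<open>N\<close>-deep paths for some \<open>N\<close> (\<open>ideal_act\<close>). This replaces a faithful
  representation of \<open>L\<^sub>R(E)\<close> on infinite paths.

  Every element has a matrix indexed by paths, with entries in \<open>R\<close>, and the matrix of \<open>x\<^sup>*\<close> is the
  conjugate transpose of that of \<open>x\<close>. If \<open>x\<close> represents a projection, then on a deep path \<open>\<beta>\<close> the
  relation \<open>x = x\<^sup>* x\<close> yields \<open>x\<^sub>\<beta>\<^sub>\<beta> = \<Sum>\<^sub>\<alpha> \<bar>x\<^sub>\<alpha>\<^sub>\<beta>\<bar>\<^sup>2\<close>, a finite sum, and kindness of \<open>R\<close> kills every \<open>x\<^sub>\<alpha>\<^sub>\<beta>\<close>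
  with \<open>\<alpha> \<noteq> \<beta>\<close> (\<open>projection_entries\<close>).

  It remains to pass from a diagonal matrix to an element of the diagonal. By the relations \<open>x\<close> is
  congruent to a combination of elements \<open>\<mu>\<nu>\<^sup>*\<close>, and repeated use of (LP5), in the form
  \<open>\<mu>\<nu>\<^sup>* = \<Sum>\<^sub>e (\<mu>e)(\<nu>e)\<^sup>*\<close>, makes every \<open>\<nu>\<close> as deep as desired (\<open>deepen_normal\<close>). The element
  \<open>\<mu>'\<nu>'\<^sup>*\<close> contributes to the entry at \<open>(\<mu>, \<nu>)\<close> only if \<open>\<mu> = \<mu>'z\<close> and \<open>\<nu> = \<nu>'z\<close> for a path \<open>z\<close>, and
  then \<open>\<mu>' \<noteq> \<nu>'\<close> whenever \<open>\<mu> \<noteq> \<nu>\<close>. Hence an off-diagonal term with \<open>\<nu>\<close> of minimal length would be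
  alone in its entry, which vanishes (\<open>normal_diagonal\<close>). Only the terms \<open>\<mu>\<mu>\<^sup>*\<close> survive.\<close>

section \<open>Kind rings\<close>

text \<open>Kindness in the form in which the columns of a matrix meet it: the distinguished index, later
  that of the diagonal entry, is an arbitrary element of a finite set.\<close>

lemma kindD:
  assumes "kind R" "finite A" "b \<in> A" "\<And>a. a \<in> A \<Longrightarrow> g a \<in> R"
    and "g b = of_real (\<Sum>a\<in>A. (cmod (g a))\<^sup>2)" "a \<in> A" "a \<noteq> b"
  shows "g a = 0"
proof -
  obtain h where h: "bij_betw h {0..<card (A - {b})} (A - {b})"
    using ex_bij_betw_nat_finite [of "A - {b}"] assms(2) by auto
  define n where "n = card (A - {b})"
  define l where "l i = (if i = 0 then g b else g (h (i - 1)))" for i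
  have hA: "h i \<in> A" if "i < n" for i
    using h that unfolding n_def by (auto simp: bij_betw_def)
  have "(\<Sum>i=0..n. (cmod (l i))\<^sup>2) = (cmod (g b))\<^sup>2 + (\<Sum>i=Suc 0..<Suc n. (cmod (l i))\<^sup>2)"
    by (simp add: l_def sum.atLeast_Suc_atMost atLeastLessThanSuc_atLeastAtMost)
  also have "(\<Sum>i=Suc 0..<Suc n. (cmod (l i))\<^sup>2) = (\<Sum>i=0..<n. (cmod (g (h i)))\<^sup>2)"
    by (subst sum.shift_bounds_Suc_ivl) (simp add: l_def)
  also have "\<dots> = (\<Sum>a\<in>A - {b}. (cmod (g a))\<^sup>2)"
    using sum.reindex_bij_betw [OF h, of "\<lambda>a. (cmod (g a))\<^sup>2"] by (simp add: n_def)
  also have "(cmod (g b))\<^sup>2 + \<dots> = (\<Sum>a\<in>A. (cmod (g a))\<^sup>2)"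
    using sum.remove [OF assms(2,3), of "\<lambda>a. (cmod (g a))\<^sup>2"] by simp
  finally have "l 0 = of_real (\<Sum>i=0..n. (cmod (l i))\<^sup>2)"
    using assms(5) by (simp add: l_def)
  moreover have "\<forall>i\<le>n. l i \<in> R"
    using assms(3,4) hA by (auto simp: l_def)
  ultimately have l0: "\<forall>i\<in>{1..n}. l i = 0"
    using assms(1) unfolding kind_def by blast
  have "a \<in> h ` {0..<n}"
    using assms(6,7) h by (simp add: bij_betw_def n_def)
  then obtain i where "i < n" "a = h i" by auto
  with l0 [rule_format, of "Suc i"] show ?thesis by (simp add: l_def)
qed

section \<open>Linear functionals on the free algebra\<close>

definition lin :: "('g fmon \<Rightarrow> complex) \<Rightarrow> ('g fmon \<Rightarrow>\<^sub>0 complex) \<Rightarrow> complex" where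
  "lin \<phi> x = (\<Sum>w\<in>Poly_Mapping.keys x. Poly_Mapping.lookup x w * \<phi> w)"

lemma lin_superset:
  assumes "finite A" "Poly_Mapping.keys x \<subseteq> A"
  shows "lin \<phi> x = (\<Sum>w\<in>A. Poly_Mapping.lookup x w * \<phi> w)"
  unfolding lin_def by (rule sum.mono_neutral_left) (use assms in \<open>auto simp: in_keys_iff\<close>)

lemma lin_zero [simp]: "lin \<phi> 0 = 0"
  by (simp add: lin_def)

lemma lin_add: "lin \<phi> (x + y) = lin \<phi> x + lin \<phi> y"
proof -
  let ?A = "Poly_Mapping.keys x \<union> Poly_Mapping.keys y"
  have "finite ?A" by simp
  then show ?thesis
    using lin_superset [of ?A x] lin_superset [of ?A y] lin_superset [of ?A "x + y"]
    by (simp add: Poly_Mapping.keys_add lookup_add distrib_right sum.distrib)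
qed

lemma lin_fscale: "lin \<phi> (fscale c x) = c * lin \<phi> x"
proof -
  have "Poly_Mapping.keys (fscale c x) \<subseteq> Poly_Mapping.keys x"
    by (auto simp: in_keys_iff lookup_fscale)
  then have "lin \<phi> (fscale c x) = (\<Sum>w\<in>Poly_Mapping.keys x. c * Poly_Mapping.lookup x w * \<phi> w)"
    by (simp add: lin_superset [of "Poly_Mapping.keys x"] lookup_fscale)
  then show ?thesis by (simp add: lin_def sum_distrib_left mult.assoc)
qed

lemma lin_uminus: "lin \<phi> (- x) = - lin \<phi> x"
  using lin_fscale [of \<phi> "- 1" x] by (simp add: fscale_minus_one)

lemma lin_diff: "lin \<phi> (x - y) = lin \<phi> x - lin \<phi> y"
  using lin_add [of \<phi> x "- y"] by (simp add: lin_uminus)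

lemma lin_sum: "lin \<phi> (sum f A) = (\<Sum>a\<in>A. lin \<phi> (f a))"
  by (induction A rule: infinite_finite_induct) (simp_all add: lin_add)

lemma lin_single [simp]: "lin \<phi> (Poly_Mapping.single w c) = c * \<phi> w"
  by (cases "c = 0") (simp_all add: lin_def)

lemma lin_fun_zero [simp]: "lin (\<lambda>w. 0) x = 0"
  by (simp add: lin_def)

lemma lin_fun_add: "lin (\<lambda>w. \<phi> w + \<psi> w) x = lin \<phi> x + lin \<psi> x"
  by (simp add: lin_def distrib_left sum.distrib)

text \<open>Convolution on the free algebra becomes iterated evaluation; this is what makes the action
  below multiplicative.\<close>

lemma lin_mult: "lin \<phi> (x * y) = lin (\<lambda>w. lin (\<lambda>v. \<phi> (v + w)) x) y"
proof (induction x rule: poly_mapping_add_induct)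
  case zero
  show ?case by simp
next
  case (add x v c)
  have "lin \<phi> (Poly_Mapping.single v c * y) = lin (\<lambda>w. c * \<phi> (v + w)) y"
    by (induction y rule: poly_mapping_add_induct)
      (simp_all add: distrib_left lin_add mult_single algebra_simps)
  with add show ?case by (simp add: distrib_right lin_add lin_fun_add)
qed

lemma lin_fstar: "lin \<phi> (fstar x) = cnj (lin (\<lambda>w. cnj (\<phi> (word_star w))) x)"
  by (induction x rule: poly_mapping_add_induct)
    (simp_all add: fstar_add lin_add fstar_single)

section \<open>The action on finite paths\<close>

context pre_digraph
begin

fun gen_act :: "('a, 'b) lpa_gen \<Rightarrow> 'a \<times> 'b list \<Rightarrow> ('a \<times> 'b list) option" where
  "gen_act (Vert v) (u, p) = (if u = v then Some (u, p) else None)"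
| "gen_act (Edge e) (u, p) = (if u = head G e then Some (tail G e, e # p) else None)"
| "gen_act (Ghost e) (u, []) = None"
| "gen_act (Ghost e) (u, f # p) = (if f = e then Some (head G e, p) else None)"

primrec list_act :: "('a, 'b) lpa_gen list \<Rightarrow> 'a \<times> 'b list \<Rightarrow> ('a \<times> 'b list) option" where
  "list_act [] \<beta> = Some \<beta>"
| "list_act (g # w) \<beta> = Option.bind (list_act w \<beta>) (gen_act g)"

text \<open>This is the action on arbitrary functions on paths, from the right: a word \<open>w\<close> sends \<open>f\<close> to
  \<open>\<beta> \<mapsto> f (w \<beta>)\<close>, read as \<open>0\<close> where \<open>w \<beta>\<close> is undefined. Hence
  \<open>act f (x * y) = act (act f x) y\<close>.\<close>

definition act :: "('a \<times> 'b list \<Rightarrow> complex) \<Rightarrow> ('a, 'b) lpa_free \<Rightarrow> 'a \<times> 'b list \<Rightarrow> complex" where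
  "act f x \<beta> = lin (\<lambda>w. case list_act (letters w) \<beta> of None \<Rightarrow> 0 | Some \<alpha> \<Rightarrow> f \<alpha>) x"

text \<open>The domain on which an element of the ideal is expected to vanish. A path that ends at a vertex
  without a relation (LP5) causes no trouble at any length, so length is demanded only of the
  paths with regular range.\<close>

definition deep_paths :: "nat \<Rightarrow> ('a \<times> 'b list) set" where
  "deep_paths N = {(u, p). \<exists>w. awalk u p w \<and> (N \<le> length p \<or> w \<notin> regular_verts G)}"

lemma list_act_append: "list_act (v @ w) \<beta> = Option.bind (list_act w \<beta>) (list_act v)"
  by (induction v) (simp_all add: Option.bind_assoc)

lemma act_zero [simp]: "act f 0 \<beta> = 0"
  by (simp add: act_def)

lemma act_add: "act f (x + y) \<beta> = act f x \<beta> + act f y \<beta>"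
  by (simp add: act_def lin_add)

lemma act_diff: "act f (x - y) \<beta> = act f x \<beta> - act f y \<beta>"
  by (simp add: act_def lin_diff)

lemma act_sum: "act f (sum g A) \<beta> = (\<Sum>a\<in>A. act f (g a) \<beta>)"
  by (simp add: act_def lin_sum)

lemma act_fscale: "act f (fscale c x) \<beta> = c * act f x \<beta>"
  by (simp add: act_def lin_fscale)

lemma act_single: "act f (Poly_Mapping.single w c) \<beta> =
    (case list_act (letters w) \<beta> of None \<Rightarrow> 0 | Some \<alpha> \<Rightarrow> c * f \<alpha>)"
  by (simp add: act_def split: option.split)

lemma act_fgen: "act f (fgen g) \<beta> = (case gen_act g \<beta> of None \<Rightarrow> 0 | Some \<alpha> \<Rightarrow> f \<alpha>)"
  by (simp add: fgen_def act_single split: option.split)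

lemma act_mult_lin: "act f (x * y) \<beta> =
    lin (\<lambda>w. case list_act (letters w) \<beta> of None \<Rightarrow> 0 | Some \<alpha> \<Rightarrow> act f x \<alpha>) y"
proof -
  have "lin (\<lambda>v. case list_act (letters (v + w)) \<beta> of None \<Rightarrow> 0 | Some \<alpha> \<Rightarrow> f \<alpha>) x =
      (case list_act (letters w) \<beta> of None \<Rightarrow> 0 | Some \<alpha> \<Rightarrow> act f x \<alpha>)" for w
    by (cases "list_act (letters w) \<beta>") (simp_all add: plus_fmon_def list_act_append act_def)
  then show ?thesis by (simp add: act_def [of f "x * y"] lin_mult)
qed

lemma act_mult: "act f (x * y) \<beta> = act (act f x) y \<beta>"
  by (simp add: act_mult_lin act_def [of "act f x"])

end

context lpa_setting
begin

abbreviation paths where "paths \<equiv> deep_paths 0"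

abbreviation point :: "'v \<times> 'e list \<Rightarrow> 'v \<times> 'e list \<Rightarrow> complex" where
  "point \<alpha> \<equiv> (\<lambda>\<gamma>. if \<gamma> = \<alpha> then 1 else 0)"

abbreviation entry where
  "entry x \<alpha> \<beta> \<equiv> act (point \<alpha>) x \<beta>"

lemma deep_paths_antimono: "M \<le> N \<Longrightarrow> deep_paths N \<subseteq> deep_paths M"
  by (auto simp: deep_paths_def)

text \<open>A generator shortens a path by at most one edge and keeps its range.\<close>

lemma gen_act_deep:
  assumes "g \<in> lpa_gens E" "\<beta> \<in> deep_paths (Suc N)" "gen_act g \<beta> = Some \<alpha>"
  shows "\<alpha> \<in> deep_paths N"
  using assms
  by (cases "(g, \<beta>)" rule: gen_act.cases)
    (auto simp: deep_paths_def awalk_Cons_iff gens_iff split: if_splits)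

lemma gen_act_paths:
  assumes "g \<in> lpa_gens E" "\<beta> \<in> paths" "gen_act g \<beta> = Some \<alpha>"
  shows "\<alpha> \<in> paths"
  using assms
  by (cases "(g, \<beta>)" rule: gen_act.cases)
    (auto simp: deep_paths_def awalk_Cons_iff gens_iff split: if_splits)

lemma list_act_deep:
  assumes "set w \<subseteq> lpa_gens E" "\<beta> \<in> deep_paths (N + length w)" "list_act w \<beta> = Some \<alpha>"
  shows "\<alpha> \<in> deep_paths N"
  using assms
proof (induction w arbitrary: N \<alpha>)
  case (Cons g w)
  from Cons.prems(3) obtain \<gamma> where "list_act w \<beta> = Some \<gamma>" "gen_act g \<gamma> = Some \<alpha>"
    by (auto simp: bind_eq_Some_conv)
  with Cons.IH [of "Suc N" \<gamma>] Cons.prems have "\<gamma> \<in> deep_paths (Suc N)" by simp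
  with gen_act_deep [of g \<gamma> N \<alpha>] Cons.prems \<open>gen_act g \<gamma> = Some \<alpha>\<close> show ?case by simp
qed simp

lemma list_act_paths:
  assumes "set w \<subseteq> lpa_gens E" "\<beta> \<in> paths" "list_act w \<beta> = Some \<alpha>"
  shows "\<alpha> \<in> paths"
  using assms
  by (induction w arbitrary: \<alpha>) (auto simp: bind_eq_Some_conv intro: gen_act_paths)

text \<open>The generators act by partial injections of the set of paths, and the involution inverts
  them. Validity of the path matters: to undo a ghost edge, the source that is recorded with the
  path has to be the tail of its first edge.\<close>

lemma gen_act_star:
  assumes "\<beta> \<in> paths" "gen_act g \<beta> = Some \<alpha>"
  shows "gen_act (gen_star g) \<alpha> = Some \<beta>"
  using assms
  by (cases "(g, \<beta>)" rule: gen_act.cases)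
    (auto simp: deep_paths_def awalk_Cons_iff split: if_splits)

lemma list_act_star:
  assumes "set w \<subseteq> lpa_gens E" "\<beta> \<in> paths" "list_act w \<beta> = Some \<alpha>"
  shows "list_act (map gen_star (rev w)) \<alpha> = Some \<beta>"
  using assms
proof (induction w arbitrary: \<alpha>)
  case (Cons g w)
  from Cons.prems(3) obtain \<gamma> where \<gamma>: "list_act w \<beta> = Some \<gamma>" "gen_act g \<gamma> = Some \<alpha>"
    by (auto simp: bind_eq_Some_conv)
  have "\<gamma> \<in> paths" using list_act_paths [OF _ _ \<gamma>(1)] Cons.prems by simp
  with \<gamma> gen_act_star have "gen_act (gen_star g) \<alpha> = Some \<gamma>" by blast
  with Cons \<gamma> show ?case by (simp add: list_act_append)
qed simp

lemma list_act_star_iff: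
  assumes "set w \<subseteq> lpa_gens E" "\<alpha> \<in> paths" "\<beta> \<in> paths"
  shows "list_act (map gen_star (rev w)) \<alpha> = Some \<beta> \<longleftrightarrow> list_act w \<beta> = Some \<alpha>"
proof
  assume "list_act (map gen_star (rev w)) \<alpha> = Some \<beta>"
  moreover have "set (map gen_star (rev w)) \<subseteq> lpa_gens E"
    using assms(1) gen_star_gens by auto
  ultimately show "list_act w \<beta> = Some \<alpha>"
    using list_act_star [of "map gen_star (rev w)" \<alpha> \<beta>] assms(2) by (simp add: rev_map comp_def)
qed (use assms list_act_star in blast)

text \<open>The matrix of the adjoint is the conjugate transpose, since \<open>w\<^sup>*\<close> acts as the inverse of \<open>w\<close>.\<close>

lemma entry_fstar:
  assumes "x \<in> F" "\<alpha> \<in> paths" "\<beta> \<in> paths"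
  shows "entry (fstar x) \<alpha> \<beta> = cnj (entry x \<beta> \<alpha>)"
proof -
  have "cnj (case list_act (letters (word_star w)) \<beta> of None \<Rightarrow> 0 | Some \<gamma> \<Rightarrow> point \<alpha> \<gamma>) =
      (case list_act (letters w) \<alpha> of None \<Rightarrow> 0 | Some \<gamma> \<Rightarrow> point \<beta> \<gamma>)"
    if "w \<in> Poly_Mapping.keys x" for w
  proof -
    have "set (letters w) \<subseteq> lpa_gens E" using assms(1) that by (auto simp: free_alg_def)
    from list_act_star_iff [OF this assms(3,2)] show ?thesis
      by (auto simp: word_star_def split: option.split)
  qed
  then have "lin (\<lambda>w. cnj (case list_act (letters (word_star w)) \<beta> of None \<Rightarrow> 0 | Some \<gamma> \<Rightarrow> point \<alpha> \<gamma>)) x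
     = entry x \<beta> \<alpha>"
    unfolding act_def lin_def by (intro sum.cong) simp_all
  then show ?thesis by (simp add: act_def [of _ "fstar x"] lin_fstar)
qed

text \<open>A finite set containing the row indices of the nonzero entries in the column of \<open>\<beta>\<close>.\<close>

definition reach :: "('v, 'e) lpa_free \<Rightarrow> 'v \<times> 'e list \<Rightarrow> ('v \<times> 'e list) set" where
  "reach x \<beta> = {\<alpha>. \<exists>w\<in>Poly_Mapping.keys x. list_act (letters w) \<beta> = Some \<alpha>}"

lemma finite_reach: "finite (reach x \<beta>)"
proof -
  have "reach x \<beta> \<subseteq> (\<lambda>w. the (list_act (letters w) \<beta>)) ` Poly_Mapping.keys x"
    by (force simp: reach_def)
  then show ?thesis by (rule finite_subset) simp
qed

lemma reach_paths: "x \<in> F \<Longrightarrow> \<beta> \<in> paths \<Longrightarrow> reach x \<beta> \<subseteq> paths"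
  unfolding reach_def free_alg_def using list_act_paths by blast

lemma entry_notin_reach: "\<alpha> \<notin> reach x \<beta> \<Longrightarrow> entry x \<alpha> \<beta> = 0"
  unfolding act_def lin_def
  by (rule sum.neutral) (auto simp: reach_def split: option.split)

lemma act_eq_sum_entry:
  assumes "finite A" "reach x \<beta> \<subseteq> A"
  shows "act f x \<beta> = (\<Sum>\<alpha>\<in>A. f \<alpha> * entry x \<alpha> \<beta>)"
proof -
  have "(case list_act (letters w) \<beta> of None \<Rightarrow> 0 | Some \<gamma> \<Rightarrow> f \<gamma>) =
     (\<Sum>\<alpha>\<in>A. f \<alpha> * (case list_act (letters w) \<beta> of None \<Rightarrow> 0 | Some \<gamma> \<Rightarrow> point \<alpha> \<gamma>))"
    if "w \<in> Poly_Mapping.keys x" for w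
  proof (cases "list_act (letters w) \<beta>")
    case (Some \<gamma>)
    with that assms(2) have "\<gamma> \<in> A" by (auto simp: reach_def)
    have "(\<Sum>\<alpha>\<in>A. f \<alpha> * point \<alpha> \<gamma>) = (\<Sum>\<alpha>\<in>A. if \<alpha> = \<gamma> then f \<alpha> else 0)"
      by (rule sum.cong) auto
    with \<open>\<gamma> \<in> A\<close> Some assms(1) show ?thesis by simp
  qed simp
  then have "act f x \<beta> = lin (\<lambda>w. \<Sum>\<alpha>\<in>A. f \<alpha> *
      (case list_act (letters w) \<beta> of None \<Rightarrow> 0 | Some \<gamma> \<Rightarrow> point \<alpha> \<gamma>)) x"
    unfolding act_def lin_def by (intro sum.cong) auto
  also have "\<dots> = (\<Sum>\<alpha>\<in>A. f \<alpha> * entry x \<alpha> \<beta>)"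
    unfolding act_def lin_def sum_distrib_left mult.left_commute [of "f _"]
    by (rule sum.swap)
  finally show ?thesis .
qed

lemma entry_in_R: "x \<in> F \<Longrightarrow> entry x \<alpha> \<beta> \<in> R"
proof -
  assume "x \<in> F"
  then have x: "Poly_Mapping.lookup x w \<in> R" for w by (simp add: free_alg_def)
  have "sum f A \<in> R" if "\<And>w. f w \<in> R" for f :: "('v, 'e) lpa_gen fmon \<Rightarrow> complex" and A
    by (induction A rule: infinite_finite_induct) (use that R_simps in auto)
  then show ?thesis
    unfolding act_def lin_def using x R_simps by (auto split: option.split)
qed

section \<open>The defining relations hold on deep paths\<close>

text \<open>Only (LP5) needs depth. On a nonempty path starting at \<open>v\<close>, exactly one summand \<open>e e\<^sup>*\<close>, the one for
  the first edge, acts as the identity and the others vanish; on the empty path at \<open>v\<close> they all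
  vanish, but that path is not \<open>1\<close>-deep when \<open>v\<close> is regular.\<close>

lemma rels_act:
  assumes "x \<in> lpa_rels E" "\<beta> \<in> deep_paths 1"
  shows "act f x \<beta> = 0"
proof -
  obtain u p where \<beta>: "\<beta> = (u, p)" by fastforce
  from assms(2) obtain w where w: "awalk u p w" "p \<noteq> [] \<or> w \<notin> regular_verts E"
    unfolding \<beta> deep_paths_def by (auto simp: Suc_le_eq)
  show ?thesis
    using assms(1)
  proof cases
    case (LP5 v)
    have gh: "act f (fgen (Edge e) * fgen (Ghost e)) \<beta> = (if p \<noteq> [] \<and> hd p = e then f \<beta> else 0)" for e
      using w(1) by (cases p) (auto simp: \<beta> act_mult act_fgen awalk_Cons_iff)
    have fin: "finite (out_arcs E v)" using LP5 by (simp add: regular_verts_def)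
    show ?thesis
    proof (cases p)
      case Nil
      with w have "u \<notin> regular_verts E" by (simp add: awalk_Nil_iff)
      with LP5 Nil show ?thesis by (auto simp: act_diff act_sum gh) (auto simp: \<beta> act_fgen)
    next
      case (Cons e q)
      with w(1) have "e \<in> arcs E" "tail E e = u" by (auto simp: awalk_Cons_iff)
      then have "e \<in> out_arcs E v \<longleftrightarrow> u = v" by auto
      with Cons fin show ?thesis unfolding LP5(1) by (simp add: act_diff act_sum gh) (simp add: \<beta> act_fgen)
    qed
  qed (use w(1) in \<open>cases p; auto simp: \<beta> act_mult act_diff act_fgen awalk_Cons_iff\<close>)+
qed

text \<open>The depth grows only under multiplication from the right: to reach a path on which \<open>x\<close>
  vanishes after \<open>y\<close> has acted, one needs spare length for the longest word of \<open>y\<close>.\<close>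

lemma ideal_act:
  assumes "x \<in> I"
  obtains N where "\<And>f \<beta>. \<beta> \<in> deep_paths N \<Longrightarrow> act f x \<beta> = 0"
proof -
  have "\<exists>N. \<forall>f. \<forall>\<beta>\<in>deep_paths N. act f x \<beta> = 0"
    using assms
  proof induction
    case (rel x)
    then show ?case using rels_act by blast
  next
    case (add x y)
    then obtain M N where "\<forall>f. \<forall>\<beta>\<in>deep_paths M. act f x \<beta> = 0" "\<forall>f. \<forall>\<beta>\<in>deep_paths N. act f y \<beta> = 0"
      by blast
    then have "\<forall>f. \<forall>\<beta>\<in>deep_paths (max M N). act f (x + y) \<beta> = 0"
      using deep_paths_antimono [of M "max M N"] deep_paths_antimono [of N "max M N"]
      by (auto simp: act_add subset_iff)
    then show ?case ..
  next
    case (mult_right x y)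
    then obtain N where N: "\<forall>f. \<forall>\<beta>\<in>deep_paths N. act f x \<beta> = 0" by blast
    obtain L where L: "\<And>w. w \<in> Poly_Mapping.keys y \<Longrightarrow> length (letters w) \<le> L"
      using finite_nat_set_iff_bounded_le [of "(\<lambda>w. length (letters w)) ` Poly_Mapping.keys y"] by auto
    have "act f (x * y) \<beta> = 0" if \<beta>: "\<beta> \<in> deep_paths (N + L)" for f \<beta>
    proof -
      have "(case list_act (letters w) \<beta> of None \<Rightarrow> 0 | Some \<alpha> \<Rightarrow> act f x \<alpha>) = 0"
        if w: "w \<in> Poly_Mapping.keys y" for w
      proof (cases "list_act (letters w) \<beta>")
        case (Some \<alpha>)
        have "set (letters w) \<subseteq> lpa_gens E" using w mult_right by (auto simp: free_alg_def)
        moreover have "\<beta> \<in> deep_paths (N + length (letters w))"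
          using \<beta> L [OF w] deep_paths_antimono [of "N + length (letters w)" "N + L"] by auto
        ultimately have "\<alpha> \<in> deep_paths N" using Some list_act_deep by blast
        with N Some show ?thesis by simp
      qed simp
      then show ?thesis unfolding act_mult_lin lin_def by (intro sum.neutral) auto
    qed
    then show ?case by blast
  qed (auto simp: act_fscale act_mult)
  with that show ?thesis by blast
qed


section \<open>Projections have no off-diagonal entries at deep paths\<close>

text \<open>The heart of the argument: at a deep path the diagonal entry is the sum of the squared
  absolute values of its column, to which kindness applies.\<close>

lemma projection_entries:
  assumes "kind R" "x \<in> F" "fstar x - x \<in> I" "x * x - x \<in> I"
  obtains N where "\<And>\<alpha> \<beta>. \<beta> \<in> deep_paths N \<Longrightarrow> \<alpha> \<noteq> \<beta> \<Longrightarrow> \<alpha> \<in> paths \<Longrightarrow> entry x \<alpha> \<beta> = 0"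
proof -
  obtain K where K: "\<And>f \<beta>. \<beta> \<in> deep_paths K \<Longrightarrow> act f (fstar x - x) \<beta> = 0"
    using ideal_act [OF assms(3)] by blast
  obtain L where L: "\<And>f \<beta>. \<beta> \<in> deep_paths L \<Longrightarrow> act f (x * x - x) \<beta> = 0"
    using ideal_act [OF assms(4)] by blast
  have "entry x \<alpha> \<beta> = 0" if \<beta>: "\<beta> \<in> deep_paths (max K L)" and \<alpha>: "\<alpha> \<noteq> \<beta>" "\<alpha> \<in> paths" for \<alpha> \<beta>
  proof (cases "\<alpha> \<in> reach x \<beta>")
    case True
    have \<beta>K: "\<beta> \<in> deep_paths K" and \<beta>L: "\<beta> \<in> deep_paths L" and \<beta>0: "\<beta> \<in> paths"
      using \<beta> deep_paths_antimono [of K "max K L"] deep_paths_antimono [of L "max K L"]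
        deep_paths_antimono [of 0 "max K L"] by auto
    \<comment> \<open>The column contains the diagonal index even if the corresponding entry is zero.\<close>
    define A where "A = insert \<beta> (reach x \<beta>)"
    have A: "finite A" "reach x \<beta> \<subseteq> A" "A \<subseteq> paths"
      using finite_reach reach_paths [OF assms(2) \<beta>0] \<beta>0 by (auto simp: A_def)
    have adj: "entry x \<beta> \<gamma> = cnj (entry x \<gamma> \<beta>)" if "\<gamma> \<in> A" for \<gamma>
    proof -
      have "\<gamma> \<in> paths" using A(3) that by auto
      from entry_fstar [OF assms(2) this \<beta>0] have "cnj (entry x \<beta> \<gamma>) = entry (fstar x) \<gamma> \<beta>"
        by simp
      also have "\<dots> = entry x \<gamma> \<beta>" using K [OF \<beta>K] by (simp add: act_diff)
      finally show ?thesis by (metis complex_cnj_cnj)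
    qed
    have "entry x \<beta> \<beta> = act (point \<beta>) (x * x) \<beta>" using L [OF \<beta>L] by (simp add: act_diff)
    also have "\<dots> = (\<Sum>\<gamma>\<in>A. entry x \<beta> \<gamma> * entry x \<gamma> \<beta>)"
      unfolding act_mult by (rule act_eq_sum_entry [OF A(1,2)])
    also have "\<dots> = (\<Sum>\<gamma>\<in>A. of_real ((cmod (entry x \<gamma> \<beta>))\<^sup>2))"
      by (rule sum.cong) (simp_all add: adj complex_norm_square mult.commute del: of_real_power)
    finally have "entry x \<beta> \<beta> = of_real (\<Sum>\<gamma>\<in>A. (cmod (entry x \<gamma> \<beta>))\<^sup>2)"
      by simp
    from kindD [OF assms(1) A(1) _ _ this, of \<alpha>] show ?thesis
      using True \<alpha> entry_in_R [OF assms(2)] by (simp add: A_def)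
  qed (rule entry_notin_reach)
  with that show ?thesis by blast
qed

section \<open>Rewriting words to normal form\<close>

abbreviation monomial :: "('v, 'e) lpa_gen list \<Rightarrow> ('v, 'e) lpa_free" where
  "monomial w \<equiv> Poly_Mapping.single (Word w) 1"

text \<open>Equality and vanishing of words in \<open>L\<^sub>R(E)\<close>, so that the relations can be used as rewrite
  rules inside words.\<close>

definition eqv :: "('v, 'e) lpa_gen list \<Rightarrow> ('v, 'e) lpa_gen list \<Rightarrow> bool" where
  "eqv v w \<longleftrightarrow> monomial v - monomial w \<in> I"

definition nul :: "('v, 'e) lpa_gen list \<Rightarrow> bool" where
  "nul w \<longleftrightarrow> monomial w \<in> I"

lemma monomial_append: "monomial (v @ w) = monomial v * monomial w"
  by (simp add: mult_single plus_fmon_def)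

lemma monomial_Nil: "monomial [] = 1"
  by (simp add: single_one [symmetric] zero_fmon_def del: single_one)

lemma ideal_context:
  assumes "x \<in> I" "set v \<subseteq> lpa_gens E" "set w \<subseteq> lpa_gens E"
  shows "monomial v * x * monomial w \<in> I"
proof -
  have l: "monomial v * y \<in> I" if "y \<in> I" for y
    using that assms(2)
    by (cases "v = []") (auto simp: monomial_Nil intro!: lpa_ideal.mult_left F_single R_simps)
  have "y * monomial w \<in> I" if "y \<in> I" for y
    using that assms(3)
    by (cases "w = []") (auto simp: monomial_Nil intro!: lpa_ideal.mult_right F_single R_simps)
  with l assms(1) show ?thesis by blast
qed

lemma eqv_refl: "eqv w w"
  by (simp add: eqv_def lpa_ideal.zero)

lemma eqv_sym: "eqv v w \<Longrightarrow> eqv w v"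
  using ideal_uminus [of "monomial v - monomial w"] by (simp add: eqv_def)

lemma eqv_trans [trans]: "eqv u v \<Longrightarrow> eqv v w \<Longrightarrow> eqv u w"
  using lpa_ideal.add [of "monomial u - monomial v" R E "monomial v - monomial w"] by (simp add: eqv_def)

lemma eqv_nul: "eqv v w \<Longrightarrow> nul w \<Longrightarrow> nul v"
  using lpa_ideal.add [of "monomial v - monomial w" R E "monomial w"] by (simp add: eqv_def nul_def)

lemma eqv_context:
  assumes "eqv a b" "set v \<subseteq> lpa_gens E" "set w \<subseteq> lpa_gens E"
  shows "eqv (v @ a @ w) (v @ b @ w)"
  using ideal_context [of "monomial a - monomial b" v w] assms
  by (simp add: eqv_def monomial_append left_diff_distrib right_diff_distrib mult.assoc)

lemma nul_context:
  assumes "nul a" "set v \<subseteq> lpa_gens E" "set w \<subseteq> lpa_gens E"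
  shows "nul (v @ a @ w)"
  using ideal_context [of "monomial a" v w] assms
  by (simp add: nul_def monomial_append mult.assoc)

lemma fgen_monomial: "fgen g = monomial [g]"
  by (simp add: fgen_def)

lemma fgen_mult: "fgen g * fgen h = monomial [g, h]"
  by (simp add: fgen_monomial monomial_append [symmetric])

lemma eqv_gens:
  "v \<in> verts E \<Longrightarrow> eqv [Vert v, Vert v] [Vert v]"
  "e \<in> arcs E \<Longrightarrow> eqv [Ghost e, Edge e] [Vert (head E e)]"
  "e \<in> arcs E \<Longrightarrow> eqv [Vert (tail E e), Edge e] [Edge e]"
  "e \<in> arcs E \<Longrightarrow> eqv [Edge e, Vert (head E e)] [Edge e]"
  "e \<in> arcs E \<Longrightarrow> eqv [Ghost e, Vert (tail E e)] [Ghost e]"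
  "e \<in> arcs E \<Longrightarrow> eqv [Vert (head E e), Ghost e] [Ghost e]"
  unfolding eqv_def fgen_mult [symmetric] fgen_monomial [symmetric]
  by (rule lpa_ideal.rel, rule lpa_rels.intros, assumption)+

lemma nul_gens:
  "v \<in> verts E \<Longrightarrow> w \<in> verts E \<Longrightarrow> v \<noteq> w \<Longrightarrow> nul [Vert v, Vert w]"
  "e \<in> arcs E \<Longrightarrow> f \<in> arcs E \<Longrightarrow> e \<noteq> f \<Longrightarrow> nul [Ghost e, Edge f]"
  unfolding nul_def fgen_mult [symmetric]
  by (rule lpa_ideal.rel, rule lpa_rels.intros, assumption+)+

text \<open>Letters that do not compose annihilate each other: by (LP3) and (LP4) a vertex can be inserted
  between them, and distinct vertices are orthogonal.\<close>

lemma nul_mismatch: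
  "e \<in> arcs E \<Longrightarrow> v \<in> verts E \<Longrightarrow> v \<noteq> tail E e \<Longrightarrow> nul [Vert v, Edge e]"
  "e \<in> arcs E \<Longrightarrow> v \<in> verts E \<Longrightarrow> v \<noteq> head E e \<Longrightarrow> nul [Edge e, Vert v]"
  "e \<in> arcs E \<Longrightarrow> v \<in> verts E \<Longrightarrow> v \<noteq> tail E e \<Longrightarrow> nul [Ghost e, Vert v]"
  "e \<in> arcs E \<Longrightarrow> f \<in> arcs E \<Longrightarrow> tail E f \<noteq> head E e \<Longrightarrow> nul [Edge e, Edge f]"
proof -
  have 1: "nul [Vert v, Edge e]" if "e \<in> arcs E" "v \<in> verts E" "v \<noteq> tail E e" for v e
  proof -
    have "eqv [Vert v, Vert (tail E e), Edge e] [Vert v, Edge e]"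
      using eqv_context [OF eqv_gens(3) [of e], of "[Vert v]" "[]"] that by (simp add: gens_iff)
    moreover have "nul [Vert v, Vert (tail E e), Edge e]"
      using nul_context [OF nul_gens(1) [of v "tail E e"], of "[]" "[Edge e]"] that
      by (simp add: gens_iff)
    ultimately show ?thesis using eqv_nul eqv_sym by blast
  qed
  then show "e \<in> arcs E \<Longrightarrow> v \<in> verts E \<Longrightarrow> v \<noteq> tail E e \<Longrightarrow> nul [Vert v, Edge e]" .
  show "nul [Edge e, Vert v]" if "e \<in> arcs E" "v \<in> verts E" "v \<noteq> head E e"
  proof -
    have "eqv [Edge e, Vert (head E e), Vert v] [Edge e, Vert v]"
      using eqv_context [OF eqv_gens(4) [of e], of "[]" "[Vert v]"] that by (simp add: gens_iff)
    moreover have "nul [Edge e, Vert (head E e), Vert v]"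
      using nul_context [OF nul_gens(1) [of "head E e" v], of "[Edge e]" "[]"] that
      by (simp add: gens_iff)
    ultimately show ?thesis using eqv_nul eqv_sym by blast
  qed
  show "nul [Ghost e, Vert v]" if "e \<in> arcs E" "v \<in> verts E" "v \<noteq> tail E e"
  proof -
    have "eqv [Ghost e, Vert (tail E e), Vert v] [Ghost e, Vert v]"
      using eqv_context [OF eqv_gens(5) [of e], of "[]" "[Vert v]"] that by (simp add: gens_iff)
    moreover have "nul [Ghost e, Vert (tail E e), Vert v]"
      using nul_context [OF nul_gens(1) [of "tail E e" v], of "[Ghost e]" "[]"] that
      by (simp add: gens_iff)
    ultimately show ?thesis using eqv_nul eqv_sym by blast
  qed
  show "nul [Edge e, Edge f]" if "e \<in> arcs E" "f \<in> arcs E" "tail E f \<noteq> head E e"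
  proof -
    have "eqv [Edge e, Vert (head E e), Edge f] [Edge e, Edge f]"
      using eqv_context [OF eqv_gens(4) [of e], of "[]" "[Edge f]"] that by (simp add: gens_iff)
    moreover have "nul [Edge e, Vert (head E e), Edge f]"
      using nul_context [OF 1 [of f "head E e"], of "[Edge e]" "[]"] that by (simp add: gens_iff)
    ultimately show ?thesis using eqv_nul eqv_sym by blast
  qed
qed

text \<open>The words of \<open>\<mu>\<close> and of \<open>\<nu>\<^sup>*\<close>; a path of length \<open>0\<close> is a vertex and hence one letter.\<close>

definition path_letters :: "'v \<Rightarrow> 'e list \<Rightarrow> ('v, 'e) lpa_gen list" where
  "path_letters u p = (if p = [] then [Vert u] else map Edge p)"

definition ghost_letters :: "'v \<Rightarrow> 'e list \<Rightarrow> ('v, 'e) lpa_gen list" where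
  "ghost_letters v q = (if q = [] then [Vert v] else map Ghost (rev q))"

lemma path_letters_gens: "awalk u p t \<Longrightarrow> set (path_letters u p) \<subseteq> lpa_gens E"
  by (auto simp: path_letters_def awalk_def lpa_gens_def)

lemma ghost_letters_gens: "awalk v q t \<Longrightarrow> set (ghost_letters v q) \<subseteq> lpa_gens E"
  by (auto simp: ghost_letters_def awalk_def lpa_gens_def)

lemma ghost_letters_star: "Word (ghost_letters v q) = word_star (path_word v q)"
  by (simp add: ghost_letters_def path_word_def word_star_def rev_map)

lemma path_letters_snoc:
  assumes "awalk u p t" "e \<in> arcs E" "tail E e = t"
  shows "eqv (path_letters u p @ [Edge e]) (path_letters u (p @ [e]))"
  using assms eqv_gens(3) [of e] by (cases p) (auto simp: path_letters_def awalk_Nil_iff eqv_refl)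

lemma ghost_letters_snoc:
  assumes "awalk v q t" "e \<in> arcs E" "tail E e = t"
  shows "eqv (Ghost e # ghost_letters v q) (ghost_letters v (q @ [e]))"
  using assms eqv_gens(5) [of e] by (cases q) (auto simp: ghost_letters_def awalk_Nil_iff eqv_refl)

lemma path_letters_range:
  assumes "awalk u p t"
  shows "eqv (path_letters u p @ [Vert t]) (path_letters u p)"
proof (cases p rule: rev_cases)
  case Nil
  with assms show ?thesis using eqv_gens(1) [of t] by (auto simp: path_letters_def awalk_Nil_iff)
next
  case (snoc p' e)
  with assms have e: "e \<in> arcs E" "head E e = t" "set (map Edge p') \<subseteq> lpa_gens E"
    by (auto simp: awalk_Cons_iff awalk_Nil_iff awalk_def lpa_gens_def)
  then have "eqv (map Edge p' @ [Edge e, Vert t] @ []) (map Edge p' @ [Edge e] @ [])"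
    by (intro eqv_context) (use eqv_gens(4) in auto)
  then show ?thesis by (simp add: snoc path_letters_def)
qed

lemma ghost_letters_source:
  assumes "awalk v q t"
  shows "eqv (Vert t # ghost_letters v q) (ghost_letters v q)"
proof (cases q rule: rev_cases)
  case Nil
  with assms show ?thesis using eqv_gens(1) [of t] by (auto simp: ghost_letters_def awalk_Nil_iff)
next
  case (snoc q' e)
  with assms have e: "e \<in> arcs E" "head E e = t" "set (map Ghost (rev q')) \<subseteq> lpa_gens E"
    by (auto simp: awalk_Cons_iff awalk_Nil_iff awalk_def lpa_gens_def)
  then have "eqv ([] @ [Vert t, Ghost e] @ map Ghost (rev q')) ([] @ [Ghost e] @ map Ghost (rev q'))"
    by (intro eqv_context) (use eqv_gens(6) in auto)
  then show ?thesis by (simp add: snoc ghost_letters_def)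
qed

lemma path_letters_source:
  assumes "awalk u p t"
  shows "eqv (Vert u # path_letters u p) (path_letters u p)"
proof (cases p)
  case Nil
  with assms show ?thesis using eqv_gens(1) [of t] by (auto simp: path_letters_def awalk_Nil_iff)
next
  case (Cons e p')
  with assms have e: "e \<in> arcs E" "tail E e = u" "set (map Edge p') \<subseteq> lpa_gens E"
    by (auto simp: awalk_Cons_iff awalk_Nil_iff awalk_def lpa_gens_def)
  then have "eqv ([] @ [Vert u, Edge e] @ map Edge p') ([] @ [Edge e] @ map Edge p')"
    by (intro eqv_context) (use eqv_gens(3) in auto)
  then show ?thesis by (simp add: Cons path_letters_def)
qed

text \<open>Multiplying \<open>\<mu>\<close> by a generator from the left gives \<open>0\<close> or a path with the same range. The one
  exception is \<open>e\<^sup>*\<close> times the vertex \<open>s(e)\<close>, where \<open>e\<^sup>*\<close> has to be absorbed into the ghost path that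
  follows.\<close>

lemma path_left_mult:
  assumes "g \<in> lpa_gens E" "awalk u p t"
  shows "nul (g # path_letters u p)
    \<or> (\<exists>u' p'. awalk u' p' t \<and> eqv (g # path_letters u p) (path_letters u' p'))
    \<or> (\<exists>e. p = [] \<and> e \<in> arcs E \<and> tail E e = u \<and> g = Ghost e)"
proof (cases g)
  case (Vert v)
  show ?thesis
  proof (cases "v = u")
    case True
    with Vert path_letters_source assms(2) show ?thesis by blast
  next
    case False
    show ?thesis
    proof (cases p)
      case Nil
      with False Vert assms nul_gens(1) show ?thesis by (auto simp: path_letters_def awalk_Nil_iff gens_iff)
    next
      case (Cons f p')
      with assms Vert False have "nul [Vert v, Edge f]" "set (map Edge p') \<subseteq> lpa_gens E"
        by (auto intro!: nul_mismatch(1) simp: awalk_Cons_iff gens_iff) (auto simp: awalk_def lpa_gens_def)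
      from nul_context [OF this(1) _ this(2), of "[]"] show ?thesis
        by (simp add: Cons Vert path_letters_def)
    qed
  qed
next
  case (Edge e)
  then have e: "e \<in> arcs E" using assms(1) by (simp add: gens_iff)
  show ?thesis
  proof (cases "head E e = u")
    case True
    then have "awalk (tail E e) (e # p) t" using assms(2) e by (simp add: awalk_Cons_iff)
    moreover have "eqv (g # path_letters u p) (path_letters (tail E e) (e # p))"
      using True e eqv_gens(4) [of e] by (auto simp: Edge path_letters_def eqv_refl)
    ultimately show ?thesis by blast
  next
    case False
    show ?thesis
    proof (cases p)
      case Nil
      with False Edge assms nul_mismatch(2) show ?thesis by (auto simp: path_letters_def awalk_Nil_iff gens_iff)
    next
      case (Cons f p')
      with assms e False have "nul [Edge e, Edge f]" "set (map Edge p') \<subseteq> lpa_gens E"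
        by (auto intro!: nul_mismatch(4) simp: awalk_Cons_iff gens_iff) (auto simp: awalk_def lpa_gens_def)
      from nul_context [OF this(1) _ this(2), of "[]"] show ?thesis
        by (simp add: Cons Edge path_letters_def)
    qed
  qed
next
  case (Ghost e)
  then have e: "e \<in> arcs E" using assms(1) by (simp add: gens_iff)
  show ?thesis
  proof (cases p)
    case Nil
    with Ghost e assms nul_mismatch(3) show ?thesis by (auto simp: path_letters_def awalk_Nil_iff gens_iff)
  next
    case (Cons f p')
    have f: "f \<in> arcs E" "awalk (head E f) p' t" and p': "set (map Edge p') \<subseteq> lpa_gens E"
      using assms(2) Cons by (auto simp: awalk_Cons_iff awalk_def lpa_gens_def)
    show ?thesis
    proof (cases "e = f")
      case False
      from nul_context [OF nul_gens(2) [OF e f(1) False] _ p', of "[]"] show ?thesis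
        by (simp add: Cons Ghost path_letters_def)
    next
      case True
      have "eqv ([] @ [Ghost f, Edge f] @ map Edge p') ([] @ [Vert (head E f)] @ map Edge p')"
        by (intro eqv_context eqv_gens(2) f p') simp
      also have "eqv ([] @ [Vert (head E f)] @ map Edge p') (path_letters (head E f) p')"
        using path_letters_source [OF f(2)] by (cases "p' = []") (simp_all add: path_letters_def eqv_refl)
      finally have "eqv (g # path_letters u p) (path_letters (head E f) p')"
        by (simp add: Ghost True Cons path_letters_def)
      with f(2) show ?thesis by blast
    qed
  qed
qed

text \<open>The classical spanning set: every word is \<open>0\<close> or of the form \<open>\<mu>\<nu>\<^sup>*\<close> with \<open>r(\<mu>) = r(\<nu>)\<close>.\<close>

lemma word_normal_form:
  assumes "w \<noteq> []" "set w \<subseteq> lpa_gens E"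
  shows "nul w \<or> (\<exists>u p v q t. awalk u p t \<and> awalk v q t \<and> eqv w (path_letters u p @ ghost_letters v q))"
  using assms
proof (induction w rule: list_nonempty_induct)
  case (single g)
  then have "g \<in> lpa_gens E" by simp
  then consider v where "g = Vert v" "v \<in> verts E" | e where "g = Edge e" "e \<in> arcs E"
    | e where "g = Ghost e" "e \<in> arcs E"
    by (auto simp: lpa_gens_def)
  then show ?case
  proof cases
    case 1
    then have "awalk v [] v \<and> eqv [g] (path_letters v [] @ ghost_letters v [])"
      using eqv_gens(1) by (simp add: awalk_Nil_iff path_letters_def ghost_letters_def eqv_sym)
    then show ?thesis by blast
  next
    case 2
    then have "awalk (tail E e) [e] (head E e) \<and> awalk (head E e) [] (head E e) \<and>
        eqv [g] (path_letters (tail E e) [e] @ ghost_letters (head E e) [])"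
      using eqv_gens(4) by (simp add: awalk_simps path_letters_def ghost_letters_def eqv_sym)
    then show ?thesis by blast
  next
    case 3
    then have "awalk (tail E e) [e] (head E e) \<and> awalk (head E e) [] (head E e) \<and>
        eqv [g] (path_letters (head E e) [] @ ghost_letters (tail E e) [e])"
      using eqv_gens(6) by (simp add: awalk_simps path_letters_def ghost_letters_def eqv_sym)
    then show ?thesis by blast
  qed
next
  case (cons g w)
  have g: "g \<in> lpa_gens E" using cons.prems by simp
  from cons consider "nul w" |
    u p v q t where "awalk u p t" "awalk v q t" "eqv w (path_letters u p @ ghost_letters v q)" by auto
  then show ?case
  proof cases
    case 1
    from nul_context [OF this, of "[g]" "[]"] g show ?thesis by simp
  next
    case 2
    note q = ghost_letters_gens [OF 2(2)]
    have gw: "eqv (g # w) ((g # path_letters u p) @ ghost_letters v q)"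
      using eqv_context [OF 2(3), of "[g]" "[]"] g by simp
    from path_left_mult [OF g 2(1)] show ?thesis
    proof (elim disjE exE conjE)
      assume "nul (g # path_letters u p)"
      from nul_context [OF this _ q, of "[]"] gw show ?thesis by (simp add: eqv_nul)
    next
      fix u' p' assume a: "awalk u' p' t" "eqv (g # path_letters u p) (path_letters u' p')"
      from eqv_context [OF a(2) _ q, of "[]"]
      have "eqv ((g # path_letters u p) @ ghost_letters v q) (path_letters u' p' @ ghost_letters v q)" by simp
      with gw have "eqv (g # w) (path_letters u' p' @ ghost_letters v q)" by (rule eqv_trans)
      with a(1) 2(2) show ?thesis by blast
    next
      fix e assume e: "p = []" "e \<in> arcs E" "tail E e = u" "g = Ghost e"
      with 2 have t: "t = u" by (simp add: awalk_Nil_iff)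
      have qe: "awalk v (q @ [e]) (head E e)"
        using 2(2) e t by (auto simp: awalk_simps)
      have "eqv (g # w) ([Ghost e, Vert u] @ ghost_letters v q)"
        using gw e by (simp add: path_letters_def)
      also have "eqv \<dots> (Ghost e # ghost_letters v q)"
        using eqv_context [OF eqv_gens(5) [OF e(2)] _ q, of "[]"] e by simp
      also have "eqv \<dots> (ghost_letters v (q @ [e]))"
        by (rule ghost_letters_snoc) (use 2 e t in auto)
      also have "eqv \<dots> (path_letters (head E e) [] @ ghost_letters v (q @ [e]))"
        using ghost_letters_source [OF qe] by (simp add: path_letters_def eqv_sym)
      finally have "eqv (g # w) (path_letters (head E e) [] @ ghost_letters v (q @ [e]))" .
      moreover have "awalk (head E e) [] (head E e)" using e by (simp add: awalk_Nil_iff)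
      ultimately show ?thesis using qe by blast
    qed
  qed
qed


section \<open>Making the second path deep\<close>

text \<open>Combinations of elements \<open>\<mu>\<nu>\<^sup>*\<close> in which every \<open>\<nu>\<close> is \<open>N\<close>-deep.\<close>

definition normal :: "nat \<Rightarrow> ('v, 'e) lpa_free set" where
  "normal N = {b \<in> F. \<forall>w\<in>Poly_Mapping.keys b. \<exists>u p v q t.
     w = Word (path_letters u p @ ghost_letters v q) \<and> awalk u p t \<and> awalk v q t \<and>
     (N \<le> length q \<or> t \<notin> regular_verts E)}"

text \<open>Membership in the ideal yields vanishing on deep paths of some unspecified depth. Making \<open>\<nu>\<close>
  deeper changes an element by such a difference, and its depth must not exceed the one that has
  been reached. The depth is therefore recorded together with membership.\<close>

definition negligible :: "nat \<Rightarrow> ('v, 'e) lpa_free set" where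
  "negligible N = {y \<in> I. \<forall>f. \<forall>\<beta>\<in>deep_paths N. act f y \<beta> = 0}"

lemma normal_zero: "0 \<in> normal N"
  by (simp add: normal_def F_zero)

lemma normal_add: "a \<in> normal N \<Longrightarrow> b \<in> normal N \<Longrightarrow> a + b \<in> normal N"
  unfolding normal_def using Poly_Mapping.keys_add [of a b] F_add by blast

lemma normal_sum: "(\<And>i. i \<in> A \<Longrightarrow> f i \<in> normal N) \<Longrightarrow> sum f A \<in> normal N"
  by (induction A rule: infinite_finite_induct) (simp_all add: normal_zero normal_add)

lemma normal_fscale: "c \<in> R \<Longrightarrow> b \<in> normal N \<Longrightarrow> fscale c b \<in> normal N"
  by (auto simp: normal_def F_scale in_keys_iff lookup_fscale)

lemma normal_monomial:
  assumes "awalk u p t" "awalk v q t" "N \<le> length q \<or> t \<notin> regular_verts E"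
  shows "monomial (path_letters u p @ ghost_letters v q) \<in> normal N"
proof -
  have "monomial (path_letters u p @ ghost_letters v q) \<in> F"
    using path_letters_gens [OF assms(1)] ghost_letters_gens [OF assms(2)]
    by (intro F_single) (auto simp: R_simps path_letters_def)
  moreover have "\<forall>w\<in>Poly_Mapping.keys (monomial (path_letters u p @ ghost_letters v q)).
      w = Word (path_letters u p @ ghost_letters v q)"
    by simp
  ultimately show ?thesis using assms unfolding normal_def by blast
qed

lemma negligible_zero: "0 \<in> negligible N"
  by (simp add: negligible_def lpa_ideal.zero)

lemma negligible_add: "x \<in> negligible N \<Longrightarrow> y \<in> negligible N \<Longrightarrow> x + y \<in> negligible N"
  by (simp add: negligible_def lpa_ideal.add act_add)

lemma negligible_sum: "(\<And>i. i \<in> A \<Longrightarrow> f i \<in> negligible N) \<Longrightarrow> sum f A \<in> negligible N"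
  by (induction A rule: infinite_finite_induct) (simp_all add: negligible_zero negligible_add)

lemma negligible_fscale: "c \<in> R \<Longrightarrow> x \<in> negligible N \<Longrightarrow> fscale c x \<in> negligible N"
  by (simp add: negligible_def lpa_ideal.scale act_fscale)

lemma sum_monomials:
  "x = (\<Sum>w\<in>Poly_Mapping.keys x. fscale (Poly_Mapping.lookup x w) (monomial (letters w)))"
proof (rule poly_mapping_eqI)
  fix v
  have "(\<Sum>w\<in>Poly_Mapping.keys x. Poly_Mapping.lookup x w * (1 when w = v)) = Poly_Mapping.lookup x v"
    by (simp add: when_def in_keys_iff if_distrib [of "(*) _"] cong: if_cong)
  then show "Poly_Mapping.lookup x v = Poly_Mapping.lookup
      (\<Sum>w\<in>Poly_Mapping.keys x. fscale (Poly_Mapping.lookup x w) (monomial (letters w))) v"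
    by (simp add: lookup_sum lookup_fscale lookup_single)
qed

text \<open>Rewriting modulo a submodule \<open>J\<close> may be done word by word. It is used with the ideal and with
  its negligible elements as \<open>J\<close>.\<close>

lemma normal_form_linear:
  assumes "x \<in> F"
    and J: "0 \<in> J" "\<And>y z. y \<in> J \<Longrightarrow> z \<in> J \<Longrightarrow> y + z \<in> J"
      "\<And>c y. c \<in> R \<Longrightarrow> y \<in> J \<Longrightarrow> fscale c y \<in> J"
    and words: "\<And>w. w \<in> Poly_Mapping.keys x \<Longrightarrow> \<exists>b\<in>normal N. monomial (letters w) - b \<in> J"
  shows "\<exists>b\<in>normal N. x - b \<in> J"
proof -
  obtain h where h: "\<And>w. w \<in> Poly_Mapping.keys x \<Longrightarrow> h w \<in> normal N \<and> monomial (letters w) - h w \<in> J"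
    using words by metis
  have R: "Poly_Mapping.lookup x w \<in> R" for w using assms(1) by (simp add: free_alg_def)
  define b where "b = (\<Sum>w\<in>Poly_Mapping.keys x. fscale (Poly_Mapping.lookup x w) (h w))"
  have "b \<in> normal N"
    unfolding b_def by (intro normal_sum normal_fscale R) (use h in blast)
  moreover have "x - b \<in> J"
  proof -
    have "(\<Sum>w\<in>A. fscale (Poly_Mapping.lookup x w) (monomial (letters w) - h w)) \<in> J"
      if "A \<subseteq> Poly_Mapping.keys x" for A
      using that by (induction A rule: infinite_finite_induct) (use J R h in auto)
    from this [OF subset_refl] show ?thesis
      by (subst sum_monomials [of x])
        (simp only: b_def fscale_diff sum_subtractf)
  qed
  ultimately show ?thesis by blast
qed

lemma free_alg_normal_form:
  assumes "x \<in> F"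
  shows "\<exists>a\<in>normal 0. x - a \<in> I"
proof (rule normal_form_linear [OF assms])
  fix w assume "w \<in> Poly_Mapping.keys x"
  with assms have "letters w \<noteq> []" "set (letters w) \<subseteq> lpa_gens E" by (auto simp: free_alg_def)
  from word_normal_form [OF this] show "\<exists>b\<in>normal 0. monomial (letters w) - b \<in> I"
  proof (elim disjE exE conjE)
    assume "nul (letters w)"
    then show ?thesis using normal_zero by (auto simp: nul_def intro!: bexI [of _ 0])
  next
    fix u p v q t assume "awalk u p t" "awalk v q t" "eqv (letters w) (path_letters u p @ ghost_letters v q)"
    then show ?thesis using normal_monomial [of u p t v q 0] unfolding eqv_def by blast
  qed
qed (auto intro: lpa_ideal.intros)

lemma list_act_Edges:
  assumes "awalk u p t"
  shows "list_act (map Edge p) (u', r) =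
    (if u' = t then Some (u, p @ r) else if p = [] then Some (u', r) else None)"
  using assms by (induction p arbitrary: u) (auto simp: awalk_simps)

lemma list_act_path_letters:
  assumes "awalk u p t"
  shows "list_act (path_letters u p) (u', r) = (if u' = t then Some (u, p @ r) else None)"
  using assms list_act_Edges [OF assms] by (auto simp: path_letters_def awalk_Nil_iff)

text \<open>The element \<open>\<mu>\<nu>\<^sup>*\<close> replaces the initial segment \<open>\<nu>\<close> of a path by \<open>\<mu>\<close>. The part \<open>\<nu>\<^sup>*\<close> is handled as
  the inverse of \<open>\<nu>\<close>.\<close>

lemma list_act_pair:
  assumes p: "awalk u p t" and q: "awalk v q t" and \<beta>: "\<beta> \<in> paths"
  shows "list_act (path_letters u p @ ghost_letters v q) \<beta> = Some \<alpha> \<longleftrightarrow>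
    (\<exists>z. \<beta> = (v, q @ z) \<and> \<alpha> = (u, p @ z))"
proof -
  have star: "ghost_letters v q = map gen_star (rev (path_letters v q))"
    by (simp add: ghost_letters_def path_letters_def rev_map comp_def)
  have g: "list_act (ghost_letters v q) \<beta> = Some (t', z) \<longleftrightarrow> t' = t \<and> \<beta> = (v, q @ z)" for t' z
  proof
    assume l: "list_act (ghost_letters v q) \<beta> = Some (t', z)"
    then have "(t', z) \<in> paths" using list_act_paths [OF ghost_letters_gens [OF q] \<beta>] by blast
    with l have "list_act (path_letters v q) (t', z) = Some \<beta>"
      unfolding star using list_act_star_iff [OF path_letters_gens [OF q] \<beta>] by blast
    then show "t' = t \<and> \<beta> = (v, q @ z)"
      by (simp add: list_act_path_letters [OF q] split: if_splits)
  next
    assume z: "t' = t \<and> \<beta> = (v, q @ z)"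
    then have "(t', z) \<in> paths" using \<beta> q by (auto simp: deep_paths_def)
    with z show "list_act (ghost_letters v q) \<beta> = Some (t', z)"
      unfolding star using list_act_star_iff [OF path_letters_gens [OF q] \<beta>, of "(t', z)"]
      by (simp add: list_act_path_letters [OF q])
  qed
  show ?thesis
    by (auto simp: list_act_append bind_eq_Some_conv g list_act_path_letters [OF p])
qed

lemma ideal_sum: "(\<And>a. a \<in> A \<Longrightarrow> f a \<in> I) \<Longrightarrow> sum f A \<in> I"
  by (induction A rule: infinite_finite_induct) (simp_all add: lpa_ideal.zero lpa_ideal.add)

text \<open>Insert the common range \<open>t\<close> between \<open>\<mu>\<close> and \<open>\<nu>\<^sup>*\<close> and expand it by (LP5).\<close>

lemma expand_pair_ideal:
  assumes "awalk u p t" "awalk v q t" "t \<in> regular_verts E"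
  shows "monomial (path_letters u p @ ghost_letters v q) -
      (\<Sum>e\<in>out_arcs E t. monomial (path_letters u (p @ [e]) @ ghost_letters v (q @ [e]))) \<in> I"
proof -
  let ?P = "path_letters u p" and ?G = "ghost_letters v q"
  note P = path_letters_gens [OF assms(1)] and G = ghost_letters_gens [OF assms(2)]
  have "eqv ((?P @ [Vert t]) @ ?G) (?P @ ?G)"
    using eqv_context [OF path_letters_range [OF assms(1)] _ G, of "[]"] by simp
  then have 1: "monomial (?P @ ?G) - monomial (?P @ [Vert t] @ ?G) \<in> I"
    using eqv_sym unfolding eqv_def by simp
  have "monomial ?P * (fgen (Vert t) - (\<Sum>e\<in>out_arcs E t. fgen (Edge e) * fgen (Ghost e))) * monomial ?G \<in> I"
    by (intro ideal_context P G lpa_ideal.rel lpa_rels.LP5 assms)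
  then have 2: "monomial (?P @ [Vert t] @ ?G) - (\<Sum>e\<in>out_arcs E t. monomial (?P @ [Edge e, Ghost e] @ ?G)) \<in> I"
    unfolding fgen_mult unfolding fgen_monomial
    by (simp add: monomial_append [symmetric] left_diff_distrib right_diff_distrib sum_distrib_left sum_distrib_right)
  have "monomial (?P @ [Edge e, Ghost e] @ ?G) - monomial (path_letters u (p @ [e]) @ ghost_letters v (q @ [e])) \<in> I"
    if "e \<in> out_arcs E t" for e
  proof -
    from that have e: "e \<in> arcs E" "tail E e = t" by auto
    have pe: "awalk u (p @ [e]) (head E e)" using assms(1) e by (auto simp: awalk_simps)
    have "eqv ((?P @ [Edge e]) @ Ghost e # ?G) (path_letters u (p @ [e]) @ Ghost e # ?G)"
      using eqv_context [OF path_letters_snoc [OF assms(1) e], of "[]" "Ghost e # ?G"] G e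
      by (simp add: gens_iff)
    also have "eqv \<dots> (path_letters u (p @ [e]) @ ghost_letters v (q @ [e]))"
      using eqv_context [OF ghost_letters_snoc [OF assms(2) e] path_letters_gens [OF pe], of "[]"] by simp
    finally show ?thesis by (simp add: eqv_def)
  qed
  then have 3: "(\<Sum>e\<in>out_arcs E t. monomial (?P @ [Edge e, Ghost e] @ ?G)
      - monomial (path_letters u (p @ [e]) @ ghost_letters v (q @ [e]))) \<in> I"
    by (rule ideal_sum)
  from lpa_ideal.add [OF lpa_ideal.add [OF 1 2] 3] show ?thesis
    by (simp add: sum_subtractf)
qed

text \<open>Both sides of the expansion act alike on every path that extends \<open>\<nu>\<close> by at least one edge, and
  both vanish where \<open>\<nu>\<close> is not an initial segment. The remaining path \<open>\<nu>\<close> itself has a regular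
  range and is too short to be deep.\<close>

lemma expand_pair_act:
  assumes p: "awalk u p t" and q: "awalk v q t" and t: "t \<in> regular_verts E"
    and \<beta>: "\<beta> \<in> deep_paths (Suc (length q))"
  shows "act f (monomial (path_letters u p @ ghost_letters v q) -
      (\<Sum>e\<in>out_arcs E t. monomial (path_letters u (p @ [e]) @ ghost_letters v (q @ [e])))) \<beta> = 0"
proof -
  have \<beta>0: "\<beta> \<in> paths" using \<beta> deep_paths_antimono [of 0 "Suc (length q)"] by auto
  have walks: "awalk u (p @ [e]) (head E e)" "awalk v (q @ [e]) (head E e)"
    if "e \<in> out_arcs E t" for e
    using that p q by (auto simp: awalk_simps)
  note pair = list_act_pair [OF p q \<beta>0]
  note pair_e = list_act_pair [OF walks \<beta>0]
  show ?thesis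
  proof (cases "\<exists>z. \<beta> = (v, q @ z)")
    case True
    then obtain z where z: "\<beta> = (v, q @ z)" ..
    have "z \<noteq> []" using \<beta> q t by (auto simp: z deep_paths_def)
    then obtain e z' where ez: "z = e # z'" by (cases z) auto
    have e: "e \<in> out_arcs E t" using \<beta>0 q by (auto simp: z ez deep_paths_def awalk_simps)
    have fin: "finite (out_arcs E t)" using t by (simp add: regular_verts_def)
    have "list_act (path_letters u p @ ghost_letters v q) \<beta> = Some (u, p @ z)" using pair z by blast
    then have 1: "act f (monomial (path_letters u p @ ghost_letters v q)) \<beta> = f (u, p @ z)" by (simp add: act_single)
    have 2: "act f (monomial (path_letters u (p @ [d]) @ ghost_letters v (q @ [d]))) \<beta> =
        (if d = e then f (u, p @ z) else 0)"
      if d: "d \<in> out_arcs E t" for d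
    proof (cases "list_act (path_letters u (p @ [d]) @ ghost_letters v (q @ [d])) \<beta>")
      case None
      then have "d \<noteq> e" using pair_e [OF d d, of "(u, p @ z)"] by (auto simp: z ez)
      with None show ?thesis by (simp add: act_single)
    next
      case (Some \<alpha>)
      then have "d = e" "\<alpha> = (u, p @ z)" using pair_e [OF d d, of \<alpha>] by (auto simp: z ez)
      with Some show ?thesis by (simp add: act_single)
    qed
    show ?thesis using e fin by (simp add: act_diff act_sum 1 2)
  next
    case False
    then have "list_act (path_letters u p @ ghost_letters v q) \<beta> = None"
      using pair by (cases "list_act (path_letters u p @ ghost_letters v q) \<beta>") auto
    moreover have "list_act (path_letters u (p @ [d]) @ ghost_letters v (q @ [d])) \<beta> = None"
      if "d \<in> out_arcs E t" for d
      using pair_e [OF that that] False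
      by (cases "list_act (path_letters u (p @ [d]) @ ghost_letters v (q @ [d])) \<beta>") auto
    ultimately show ?thesis by (simp add: act_diff act_sum act_single)
  qed
qed

lemma deepen_pair:
  assumes "awalk u p t" "awalk v q t"
  shows "\<exists>b\<in>normal N. monomial (path_letters u p @ ghost_letters v q) - b \<in> negligible N"
  using assms
proof (induction "N - length q" arbitrary: p q t)
  case 0
  then have "monomial (path_letters u p @ ghost_letters v q) \<in> normal N" by (intro normal_monomial) auto
  then show ?case using negligible_zero by (intro bexI) auto
next
  case (Suc k)
  show ?case
  proof (cases "t \<in> regular_verts E")
    case False
    with Suc have "monomial (path_letters u p @ ghost_letters v q) \<in> normal N" by (intro normal_monomial) auto
    then show ?thesis using negligible_zero by (intro bexI) auto
  next
    case True
    let ?m = "\<lambda>e. monomial (path_letters u (p @ [e]) @ ghost_letters v (q @ [e]))"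
    have "\<exists>b\<in>normal N. ?m e - b \<in> negligible N" if "e \<in> out_arcs E t" for e
      by (rule Suc.hyps(1) [where t = "head E e"])
        (use Suc.hyps(2) Suc.prems that in \<open>auto simp: awalk_simps\<close>)
    then obtain h where h: "\<And>e. e \<in> out_arcs E t \<Longrightarrow> h e \<in> normal N \<and> ?m e - h e \<in> negligible N"
      by metis
    have "monomial (path_letters u p @ ghost_letters v q) - (\<Sum>e\<in>out_arcs E t. ?m e) \<in> negligible N"
      using expand_pair_ideal [OF Suc.prems True] expand_pair_act [OF Suc.prems True]
        deep_paths_antimono [of "Suc (length q)" N] Suc.hyps(2)
      by (auto simp: negligible_def subset_iff)
    moreover have "(\<Sum>e\<in>out_arcs E t. ?m e - h e) \<in> negligible N"
      using h by (intro negligible_sum) blast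
    ultimately have "monomial (path_letters u p @ ghost_letters v q) - (\<Sum>e\<in>out_arcs E t. h e) \<in> negligible N"
      using negligible_add by (fastforce simp: sum_subtractf)
    moreover have "(\<Sum>e\<in>out_arcs E t. h e) \<in> normal N"
      using h by (intro normal_sum) blast
    ultimately show ?thesis by blast
  qed
qed

lemma deepen_normal:
  assumes "a \<in> normal 0"
  shows "\<exists>b\<in>normal N. a - b \<in> negligible N"
proof (rule normal_form_linear)
  show "a \<in> F" using assms by (simp add: normal_def)
  fix w assume "w \<in> Poly_Mapping.keys a"
  with assms obtain u p v q t where "w = Word (path_letters u p @ ghost_letters v q)" "awalk u p t" "awalk v q t"
    unfolding normal_def by blast
  then show "\<exists>b\<in>normal N. monomial (letters w) - b \<in> negligible N"
    using deepen_pair by simp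
qed (auto intro: negligible_zero negligible_add negligible_fscale)

section \<open>Reading off the diagonal\<close>

text \<open>Triangularity with respect to the length of \<open>\<nu>\<close>. Because \<open>\<nu>\<close> is deep, the entry at \<open>(\<mu>, \<nu>)\<close> is
  among those known to vanish; once shorter off-diagonal terms are excluded, this entry equals the
  coefficient of \<open>\<mu>\<nu>\<^sup>*\<close>.\<close>

lemma normal_diagonal:
  assumes b: "b \<in> normal N"
    and off: "\<And>\<alpha> \<beta>. \<beta> \<in> deep_paths N \<Longrightarrow> \<alpha> \<noteq> \<beta> \<Longrightarrow> \<alpha> \<in> paths \<Longrightarrow> entry b \<alpha> \<beta> = 0"
    and "w \<in> Poly_Mapping.keys b"
  shows "\<exists>u p t. w = Word (path_letters u p @ ghost_letters u p) \<and> awalk u p t"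
proof -
  have nf: "\<exists>u p v q t. w = Word (path_letters u p @ ghost_letters v q) \<and> awalk u p t \<and> awalk v q t \<and>
     (N \<le> length q \<or> t \<notin> regular_verts E)" if "w \<in> Poly_Mapping.keys b" for w
    using b that by (simp add: normal_def)
  have diag: "(u, p) = (v, q)"
    if "Word (path_letters u p @ ghost_letters v q) \<in> Poly_Mapping.keys b" "awalk u p t" "awalk v q t"
      "N \<le> length q \<or> t \<notin> regular_verts E" for u p v q t
    using that
  proof (induction "length q" arbitrary: u p v q t rule: less_induct)
    case less
    show ?case
    proof (rule ccontr)
      assume ne: "(u, p) \<noteq> (v, q)"
      let ?w = "Word (path_letters u p @ ghost_letters v q)"
      have deep: "(v, q) \<in> deep_paths N" using less.prems by (auto simp: deep_paths_def)
      then have q0: "(v, q) \<in> paths" using deep_paths_antimono [of 0 N] by auto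
      have "(case list_act (letters w) (v, q) of None \<Rightarrow> 0 | Some \<gamma> \<Rightarrow> point (u, p) \<gamma>) =
          (if w = ?w then 1 else 0)" if w: "w \<in> Poly_Mapping.keys b" for w
      proof (cases "list_act (letters w) (v, q) = Some (u, p)")
        case True
        obtain u' p' v' q' t' where w': "w = Word (path_letters u' p' @ ghost_letters v' q')" "awalk u' p' t'"
          "awalk v' q' t'" "N \<le> length q' \<or> t' \<notin> regular_verts E"
          using nf [OF w] by blast
        from True obtain z where z: "(v, q) = (v', q' @ z)" "(u, p) = (u', p' @ z)"
          using list_act_pair [OF w'(2,3) q0] unfolding w'(1) by auto
        have "z = []"
        proof (rule ccontr)
          assume "z \<noteq> []"
          with z have "length q' < length q" by simp
          with less.hyps [of q' u' p' v' t'] w w' have "(u', p') = (v', q')" by simp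
          with z ne show False by simp
        qed
        with z True show ?thesis by (simp add: w'(1))
      next
        case False
        moreover have "list_act (letters ?w) (v, q) = Some (u, p)"
          using list_act_pair [OF less.prems(2,3) q0] by simp
        ultimately show ?thesis by (auto split: option.split)
      qed
      then have "entry b (u, p) (v, q) =
          (\<Sum>w\<in>Poly_Mapping.keys b. if w = ?w then Poly_Mapping.lookup b w else 0)"
        unfolding act_def lin_def by (intro sum.cong) simp_all
      also have "\<dots> = Poly_Mapping.lookup b ?w"
        using less.prems(1) by simp
      finally have "entry b (u, p) (v, q) \<noteq> 0" using less.prems(1) by (simp add: in_keys_iff)
      moreover have "(u, p) \<in> paths" using less.prems(2) by (auto simp: deep_paths_def)
      ultimately show False using off [OF deep ne] by simp
    qed
  qed
  from nf [OF assms(3)] diag assms(3) show ?thesis by blast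
qed

lemma diagonal_in_lpa_diag:
  assumes "b \<in> F"
    and diag: "\<And>w. w \<in> Poly_Mapping.keys b \<Longrightarrow>
      \<exists>u p t. w = Word (path_letters u p @ ghost_letters u p) \<and> awalk u p t"
  shows "cls b \<in> lpa_diag R E"
proof -
  let ?S = "{lpa_mult R E (lpa_path R E u p) (lpa_star R E (lpa_path R E u p)) | u p v. awalk u p v}"
  let ?c = "Poly_Mapping.lookup b"
  have c: "?c w \<in> R" for w using assms(1) by (simp add: free_alg_def)
  have "(\<Sum>w\<in>A. fscale (?c w) (monomial (letters w))) \<in> F \<and>
      cls (\<Sum>w\<in>A. fscale (?c w) (monomial (letters w))) \<in> lpa_span R E ?S"
    if "finite A" "A \<subseteq> Poly_Mapping.keys b" for A
    using that
  proof (induction A)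
    case empty
    show ?case using lpa_span.zero by (simp add: F_zero)
  next
    case (insert w A)
    let ?y = "\<Sum>w\<in>A. fscale (?c w) (monomial (letters w))"
    have y: "?y \<in> F" "cls ?y \<in> lpa_span R E ?S" using insert by auto
    obtain u p t where w: "w = Word (path_letters u p @ ghost_letters u p)" "awalk u p t"
      using diag [of w] insert.prems by auto
    have P: "Poly_Mapping.single (path_word u p) 1 \<in> F" by (rule path_F [OF w(2)])
    have m: "monomial (letters w) = Poly_Mapping.single (path_word u p) 1 *
        fstar (Poly_Mapping.single (path_word u p) 1)"
      by (simp add: w(1) monomial_append fstar_single ghost_letters_star [symmetric])
        (simp add: path_letters_def path_word_def)
    have mF: "monomial (letters w) \<in> F" unfolding m by (intro F_mult F_star P)
    have "cls (monomial (letters w)) = lpa_mult R E (lpa_path R E u p) (lpa_star R E (lpa_path R E u p))"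
      unfolding m lpa_path_def by (simp add: lpa_star_cls lpa_mult_cls F_star P)
    then have "cls (monomial (letters w)) \<in> ?S" using w(2) by blast
    from lpa_span.step [OF c [of w] this y(2)]
    have "cls (fscale (?c w) (monomial (letters w)) + ?y) \<in> lpa_span R E ?S"
      by (simp only: lpa_scale_cls [OF c mF] lpa_add_cls [OF F_scale [OF c mF] y(1)])
    moreover have "fscale (?c w) (monomial (letters w)) + ?y \<in> F"
      by (intro F_add F_scale c mF y(1))
    ultimately show ?case by (simp only: sum.insert [OF insert.hyps] simp_thms)
  qed
  from this [of "Poly_Mapping.keys b"] show ?thesis
    using sum_monomials [of b] by (simp add: lpa_diag_def)
qed

text \<open>The order of choices matters: the depths \<open>K\<close> (for the projection) and \<open>L\<close> (for the passage to
  some normal form \<open>a\<close>) come first, and only then is \<open>a\<close> made deep enough without disturbing its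
  action on paths of that depth.\<close>

lemma projection_diagonal:
  assumes "kind R" "lpa_projection R E p"
  shows "p \<in> lpa_diag R E"
proof -
  from assms(2) have "p \<in> lpa R E" "lpa_star R E p = p" "lpa_mult R E p p = p"
    by (auto simp: lpa_projection_def)
  then obtain x where x: "x \<in> F" "p = cls x" by (auto simp: lpa_def elim!: quotientE)
  have "cls (fstar x) = cls x" using \<open>lpa_star R E p = p\<close> x by (simp add: lpa_star_cls)
  then have star: "fstar x - x \<in> I" using x F_star cls_eq_iff by blast
  have "cls (x * x) = cls x" using \<open>lpa_mult R E p p = p\<close> x by (simp add: lpa_mult_cls)
  then have idem: "x * x - x \<in> I" using x F_mult cls_eq_iff by blast
  obtain K where K: "\<And>\<alpha> \<beta>. \<beta> \<in> deep_paths K \<Longrightarrow> \<alpha> \<noteq> \<beta> \<Longrightarrow> \<alpha> \<in> paths \<Longrightarrow> entry x \<alpha> \<beta> = 0"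
    using projection_entries [OF assms(1) x(1) star idem] by blast
  obtain a where a: "a \<in> normal 0" "x - a \<in> I" using free_alg_normal_form [OF x(1)] by blast
  obtain L where L: "\<And>f \<beta>. \<beta> \<in> deep_paths L \<Longrightarrow> act f (x - a) \<beta> = 0"
    using ideal_act [OF a(2)] by blast
  obtain b where b: "b \<in> normal (max K L)" "a - b \<in> negligible (max K L)"
    using deepen_normal [OF a(1)] by blast
  have "entry b \<alpha> \<beta> = 0" if \<beta>: "\<beta> \<in> deep_paths (max K L)" and \<alpha>: "\<alpha> \<noteq> \<beta>" "\<alpha> \<in> paths" for \<alpha> \<beta>
  proof -
    have "\<beta> \<in> deep_paths K" "\<beta> \<in> deep_paths L"
      using \<beta> deep_paths_antimono [of K "max K L"] deep_paths_antimono [of L "max K L"] by auto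
    then have "entry x \<alpha> \<beta> = 0" "entry (x - a) \<alpha> \<beta> = 0" using K L \<alpha> by auto
    moreover have "entry (a - b) \<alpha> \<beta> = 0" using b(2) \<beta> by (simp add: negligible_def)
    ultimately show ?thesis by (simp add: act_diff)
  qed
  with normal_diagonal [OF b(1)] have
    "\<And>w. w \<in> Poly_Mapping.keys b \<Longrightarrow>
      \<exists>u p t. w = Word (path_letters u p @ ghost_letters u p) \<and> awalk u p t"
    by blast
  moreover have bF: "b \<in> F" using b(1) by (simp add: normal_def)
  ultimately have "cls b \<in> lpa_diag R E" by (intro diagonal_in_lpa_diag)
  moreover have "x - b \<in> I"
    using lpa_ideal.add [OF a(2), of "a - b"] b(2) by (simp add: negligible_def)
  ultimately show ?thesis using cls_eq_iff [OF x(1) bF] x(2) by simp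
qed

end

theorem proposition4:
  fixes E :: "('v, 'e) pre_digraph" and R :: "complex set"
  assumes "wf_digraph E"
    and "conj_subring R"
    and "kind R"
    and "lpa_projection R E p"
  shows "p \<in> lpa_diag R E"
proof -
  interpret wf_digraph E by fact
  interpret lpa_setting E R by unfold_locales fact
  show ?thesis using assms(3,4) by (rule projection_diagonal)
qed

end
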